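(* Let $n\ge 1$, let $K,L \in \mathcal{K}^n_0$, let $p,q \in [-\infty,\infty]$ with $p<q$, and let $M_p \in \{\overline{M}_p,\underline{M}_p\}$, $M_q\in\{\overline{M}_q,\underline{M}_q\}$. Write $\varepsilon := R_0^{\max}(M_p(K,L),M_q(K,L)) - 1$. (i) If $p\neq-\infty$, $q\neq\infty$, and $\varepsilon \le \frac{m_q(c,1)}{m_p(c,1)}-1$ for $c := 1+\frac{\delta}{\max\{|p|,|q|\}+3/2}$, where $\delta\in[0,1)$, then \[ R_0^{\max}(K,L)\le 1+\sqrt{\frac{8\varepsilon}{(1-\delta)(q-p)}}. \] Moreover (still for $p\ne-\infty$, $q\neq\infty$), for any $c'\ge 1$ and $\varepsilon' = \frac{m_q(c',1)}{m_p(c',1)}-1$ there exist $K',L'\in\mathcal{K}^n_0$ with \[ \varepsilon' = R_0^{\max}(M_p(K',L'),M_q(K',L'))-1 \quad\text{and}\quad 1+\sqrt{\frac{8\varepsilon'}{q-p}}\le R_0^{\max}(K',L'). \] (ii) If $p=-\infty$ and $q\ne\infty$, or $p\neq-\infty$ and $q=\infty$, then \[ R_0^{\max}(K,L) = 1+2\varepsilon+\mathcal{O}(\varepsilon^2) \] (as $\varepsilon\to0$), where the error term depends on $p$ and $q$ but not on $K$, $L$, or $n$. (iii) If $p=-\infty$ and $q=\infty$, then \[ R_0^{\max}(K,L)=1+\varepsilon. \]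
   Context: $\mathcal{K}^n_0$ denotes the set of compact convex subsets of $\mathbb{R}^n$ containing the origin in their interior. For $C\in\mathcal{K}^n_0$, $h_C(a)=\sup\{a^Tx : x\in C\}$ is the support function and $\|x\|_C=\inf\{\lambda\ge 0 : x\in\lambda C\}$ the gauge function. For $x,y>0$, $m_p(x,y)=\left(\frac{x^p+y^p}{2}\right)^{1/p}$ if $p\in\mathbb{R}\setminus\{0\}$, $m_0(x,y)=\sqrt{xy}$, $m_{-\infty}(x,y)=\min\{x,y\}$, $m_\infty(x,y)=\max\{x,y\}$. $\mathbb{S}_2$ is the Euclidean unit sphere in $\mathbb{R}^n$. For $K,L\in\mathcal{K}^n_0$ and $p\in[-\infty,\infty]$, the upper $p$-mean is \[ \overline{M}_p(K,L)=\{x\in\mathbb{R}^n : a^Tx\le m_p(h_K(a),h_L(a)) \text{ for all } a\in\mathbb{S}_2\}, \] and the lower $p$-mean is \[ \underline{M}_p(K,L)=\mathrm{conv}\left(\left\{m_p(\|v\|_K^{-1},\|v\|_L^{-1})\,v : v\in\mathbb{S}_2\right\}\right). \] The covering radius of $K$ with respect to $L$ is $R_0(K,L)=\inf\{\lambda\ge0 : K\subset\lambda L\}$, and the covering distance is $R_0^{\max}(K,L)=\max\{R_0(K,L),R_0(L,K)\}$. Asymptotic orders are understood for $0\le\varepsilon\to0$: in (ii) the meaning is that there are constants $C,\varepsilon_0>0$ depending only on $p$ and $q$ such that $|R_0^{\max}(K,L)-1-2\varepsilon|\le C\varepsilon^2$ whenever $\varepsilon\le\varepsilon_0$. *)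

theory Defs
  imports "HOL-Analysis.Analysis" "HOL-Library.Function_Algebras"
begin

text \<open>
  The dimension \<open>n\<close> has to be quantified inside a formula (an error bound is to be uniform
  in \<open>n\<close>), so \<open>\<real>\<^sup>n\<close> is the carrier of the library topology \<^term>\<open>Euclidean_space n\<close>, that is, the
  sequences \<open>x :: nat \<Rightarrow> real\<close> with \<open>x i = 0\<close> for all \<open>i \<ge> n\<close>. The pointwise vector space structure
  on functions makes \<^const>\<open>convex\<close> and the convex hull available for sets of such sequences.
\<close>

instantiation "fun" :: (type, real_vector) real_vector
begin

definition scaleR_fun :: "real \<Rightarrow> ('a \<Rightarrow> 'b) \<Rightarrow> 'a \<Rightarrow> 'b"
  where "scaleR_fun c f = (\<lambda>x. c *\<^sub>R f x)"

instance
  by standard (simp_all add: scaleR_fun_def fun_eq_iff scaleR_add_right scaleR_add_left)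

end

definition dotp :: "nat \<Rightarrow> (nat \<Rightarrow> real) \<Rightarrow> (nat \<Rightarrow> real) \<Rightarrow> real"
  where "dotp n a x = (\<Sum>i<n. a i * x i)"

definition unit_sphere :: "nat \<Rightarrow> (nat \<Rightarrow> real) set"
  where "unit_sphere n = {v \<in> topspace (Euclidean_space n). L2_set v {..<n} = 1}"

text \<open>The class \<open>\<K>\<^sup>n\<^sub>0\<close>:\<close>

definition convex_bodies0 :: "nat \<Rightarrow> (nat \<Rightarrow> real) set set"
  where "convex_bodies0 n =
    {C. convex C \<and> compactin (Euclidean_space n) C \<and> 0 \<in> (Euclidean_space n) interior_of C}"

definition support_fun :: "nat \<Rightarrow> (nat \<Rightarrow> real) set \<Rightarrow> (nat \<Rightarrow> real) \<Rightarrow> real"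
  where "support_fun n C a = Sup {dotp n a x |x. x \<in> C}"

definition gauge_fun :: "(nat \<Rightarrow> real) set \<Rightarrow> (nat \<Rightarrow> real) \<Rightarrow> real"
  where "gauge_fun C x = Inf {t. 0 \<le> t \<and> x \<in> (*\<^sub>R) t ` C}"

text \<open>The mean \<open>m\<^sub>p(x, y)\<close> for \<open>p \<in> [-\<infinity>, \<infinity>]\<close>; it is only meant for \<open>x, y > 0\<close>.\<close>

definition pmean :: "ereal \<Rightarrow> real \<Rightarrow> real \<Rightarrow> real"
  where "pmean p x y = (case p of
      ereal r \<Rightarrow> if r = 0 then sqrt (x * y) else ((x powr r + y powr r) / 2) powr (1 / r)
    | PInfty \<Rightarrow> max x y
    | MInfty \<Rightarrow> min x y)"

definition upper_mean :: "nat \<Rightarrow> ereal \<Rightarrow> (nat \<Rightarrow> real) set \<Rightarrow> (nat \<Rightarrow> real) set \<Rightarrow> (nat \<Rightarrow> real) set"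
  where "upper_mean n p K L =
    {x \<in> topspace (Euclidean_space n).
       \<forall>a\<in>unit_sphere n. dotp n a x \<le> pmean p (support_fun n K a) (support_fun n L a)}"

definition lower_mean :: "nat \<Rightarrow> ereal \<Rightarrow> (nat \<Rightarrow> real) set \<Rightarrow> (nat \<Rightarrow> real) set \<Rightarrow> (nat \<Rightarrow> real) set"
  where "lower_mean n p K L =
    convex hull {pmean p (inverse (gauge_fun K v)) (inverse (gauge_fun L v)) *\<^sub>R v |v.
      v \<in> unit_sphere n}"

definition cov_radius :: "(nat \<Rightarrow> real) set \<Rightarrow> (nat \<Rightarrow> real) set \<Rightarrow> real"
  where "cov_radius K L = Inf {t. 0 \<le> t \<and> K \<subseteq> (*\<^sub>R) t ` L}"

definition cov_dist :: "(nat \<Rightarrow> real) set \<Rightarrow> (nat \<Rightarrow> real) set \<Rightarrow> real"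
  where "cov_dist K L = max (cov_radius K L) (cov_radius L K)"

end

theory Submission
  imports Defs
begin

text \<open>
  Let \<open>R\<close> be the covering distance of \<open>K\<close> and \<open>L\<close> and let \<open>f R\<close> be the quotient of the numbers
  \<open>m\<^sub>q(R, 1)\<close> and \<open>m\<^sub>p(R, 1)\<close>. All of the geometry is the comparison of \<open>f R\<close> with the
  covering distance of the two means; the rest is calculus with the function \<open>f\<close>.

  The lower mean is always contained in the upper mean, so every property of the means that is used
  here is phrased for a set between the two.

  \<^item> The covering distance of the means is at least \<open>f R\<close> (lemma \<open>cov_dist_means_ge\<close>). Suppose that
  \<open>R\<close> comes from covering \<open>K\<close> by \<open>L\<close>. For \<open>t < R\<close> a point \<open>x\<close> of \<open>K\<close> lies outside \<open>t L\<close>, and a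
  direction \<open>a\<close> separates it from \<open>t L\<close>. On the ray of \<open>x\<close> the lower \<open>q\<close>-mean reaches at least
  \<open>m\<^sub>q(1, 1/R) x\<close>, while in the direction \<open>a\<close> the upper \<open>p\<close>-mean reaches at most
  \<open>m\<^sub>p(R, 1)\<close> times the support function of \<open>L\<close>. Comparing both values and letting \<open>t\<close> tend to
  \<open>R\<close> gives the bound.

  \<^item> Equality holds if \<open>p = -\<infinity>\<close> or \<open>q = \<infinity>\<close> (lemma \<open>cov_dist_means_eq\<close>): all means for \<open>-\<infinity>\<close>
  are \<open>K \<inter> L\<close>, all means for \<open>\<infinity>\<close> are the convex hull of \<open>K \<union> L\<close>, and these two sets can be
  compared with any other mean by monotonicity of \<open>m\<^sub>p\<close>. Since \<open>f R = R\<close> for \<open>p = -\<infinity>\<close> and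
  \<open>q = \<infinity>\<close>, this is part (iii).

  \<^item> Equality also holds for \<open>K = c L\<close> with \<open>c \<ge> 1\<close>, because then every \<open>p\<close>-mean is
  \<open>m\<^sub>p(c, 1) L\<close>. Such pairs give the sharpness in part (i).

  For the calculus put \<open>R = exp u\<close>. The logarithm of \<open>m\<^sub>p(exp u, 1)\<close> has the derivative
  \<open>(1 + tanh (p u / 2)) / 2\<close>, for \<open>p = 0\<close> as well, so the logarithm of \<open>f\<close> has the derivative
  \<open>(tanh (q u / 2) - tanh (p u / 2)) / 2\<close>. It is positive for \<open>u > 0\<close>, and since \<open>tanh\<close> has slopes
  between \<open>1 - M\<^sup>2\<close> and \<open>1\<close> on \<open>[-M, M]\<close>, the logarithm of \<open>f\<close> is \<open>(q - p) u\<^sup>2 / 8\<close> up to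
  a term of order \<open>u\<^sup>4\<close>. Lemmas \<open>pmean_ratio_ge\<close> and \<open>pmean_ratio_le\<close> are the resulting
  bounds of \<open>f\<close> by parabolas, which are the two square roots in part (i). In part (ii) the function
  \<open>f\<close> is a single mean \<open>m\<^sub>s(R, 1)\<close>, whose expansion at \<open>R = 1\<close> is inverted in lemma
  \<open>pmean_expansion_at_one\<close>.
\<close>

section \<open>Power means of two positive numbers\<close>

lemma pmean_real: "pmean (ereal r) x y =
    (if r = 0 then sqrt (x * y) else ((x powr r + y powr r) / 2) powr (1 / r))"
  by (simp add: pmean_def)

lemma pmean_PInf [simp]: "pmean \<infinity> x y = max x y"
  by (simp add: pmean_def)

lemma pmean_MInf [simp]: "pmean (-\<infinity>) x y = min x y"
  by (simp add: pmean_def)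

lemma pmean_commute: "pmean p x y = pmean p y x"
  by (cases p) (simp_all add: pmean_real mult.commute add.commute max.commute min.commute)

lemma pmean_pos:
  assumes "0 < x" "0 < y"
  shows "0 < pmean p x y"
proof (cases p)
  case (real r)
  have "0 < x powr r + y powr r" using assms by (simp add: add_pos_pos)
  then show ?thesis using assms real by (simp add: pmean_real)
qed (use assms in simp_all)

lemma pmean_scale:
  assumes "0 < c" "0 < x" "0 < y"
  shows "pmean p (c * x) (c * y) = c * pmean p x y"
proof (cases p)
  case (real r)
  show ?thesis
  proof (cases "r = 0")
    case True
    then show ?thesis using assms real by (simp add: pmean_real real_sqrt_mult)
  next
    case False
    have "(c * x) powr r + (c * y) powr r = c powr r * (x powr r + y powr r)"
      using assms by (simp add: powr_mult algebra_simps)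
    then have "(((c * x) powr r + (c * y) powr r) / 2) powr (1 / r)
        = (c powr r * ((x powr r + y powr r) / 2)) powr (1 / r)" by simp
    also have "\<dots> = c * ((x powr r + y powr r) / 2) powr (1 / r)"
      using assms False by (subst powr_mult) (auto simp: powr_powr)
    finally show ?thesis using real False by (simp add: pmean_real)
  qed
qed (use assms in \<open>simp_all add: max_mult_distrib_left min_mult_distrib_left\<close>)

lemma pmean_mono:
  assumes "0 < x" "x \<le> x'" "0 < y" "y \<le> y'"
  shows "pmean p x y \<le> pmean p x' y'"
proof (cases p)
  case (real r)
  consider "r = 0" | "r > 0" | "r < 0" by linarith
  then show ?thesis
  proof cases
    case 1
    then show ?thesis using assms real by (auto simp: pmean_real intro!: mult_mono)
  next
    case 2
    have "x powr r + y powr r \<le> x' powr r + y' powr r"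
      using assms 2 by (intro add_mono powr_mono2) auto
    then show ?thesis using real 2 by (auto simp: pmean_real intro!: powr_mono2)
  next
    case 3
    have "x' powr r + y' powr r \<le> x powr r + y powr r"
      using assms 3 by (intro add_mono powr_mono2') auto
    moreover have "0 < x' powr r + y' powr r" using assms by (simp add: add_pos_pos)
    ultimately show ?thesis using real 3 by (auto simp: pmean_real intro!: powr_mono2')
  qed
qed (use assms in auto)

lemma pmean_same: "0 < x \<Longrightarrow> pmean p x x = x"
  by (cases p) (auto simp: pmean_real powr_powr)

lemma min_le_pmean: "0 < x \<Longrightarrow> 0 < y \<Longrightarrow> min x y \<le> pmean p x y"
  using pmean_mono[of "min x y" x "min x y" y p] pmean_same[of "min x y" p] by auto

lemma pmean_le_max: "0 < x \<Longrightarrow> 0 < y \<Longrightarrow> pmean p x y \<le> max x y"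
  using pmean_mono[of x "max x y" y "max x y" p] pmean_same[of "max x y" p] by auto

lemma pmean_reciprocal:
  assumes "0 < x"
  shows "pmean p 1 (1 / x) = pmean p x 1 / x"
  using pmean_scale[of "1 / x" x 1 p] assms by simp

text \<open>
  Inversion of both arguments exchanges \<open>m\<^sub>r\<close> and \<open>m\<^sub>-\<^sub>r\<close>. This reduces the case \<open>q = \<infinity>\<close> of
  part (ii) to the case \<open>p = -\<infinity>\<close>.
\<close>

lemma max_div_pmean:
  assumes "1 \<le> x"
  shows "x / pmean (ereal r) x 1 = pmean (ereal (- r)) x 1"
proof (cases "r = 0")
  case True
  then show ?thesis using assms by (simp add: pmean_real real_div_sqrt)
next
  case False
  have "(x powr (- r) + 1) / 2 = x powr (- r) * ((x powr r + 1) / 2)"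
    using assms by (simp add: powr_minus field_simps)
  then have "((x powr (- r) + 1) / 2) powr (1 / - r) 
     = (x powr (- r)) powr (1 / - r) * ((x powr r + 1) / 2) powr (1 / - r)"
    by (simp only:) (subst powr_mult, auto)
  also have "\<dots> = x / ((x powr r + 1) / 2) powr (1 / r)"
  proof -
    have "(x powr (- r)) powr (1 / - r) = x" using assms False by (simp add: powr_powr)
    moreover have "((x powr r + 1) / 2) powr (1 / - r) = inverse (((x powr r + 1) / 2) powr (1 / r))"
      by (simp add: powr_minus[symmetric])
    ultimately show ?thesis by (simp only: divide_inverse)
  qed
  finally show ?thesis using False assms by (simp add: pmean_real)
qed

section \<open>Logarithms of power means and the ratio of two of them\<close>

text \<open>
  The means are homogeneous, so they are determined by their values at \<open>(exp u, 1)\<close>; in the variable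
  \<open>u\<close> the derivative has the same form for every real exponent, \<open>0\<close> included.
\<close>

definition log_mean :: "real \<Rightarrow> real \<Rightarrow> real"
  where "log_mean r u = ln (pmean (ereal r) (exp u) 1)"

lemma log_mean_0 [simp]: "log_mean r 0 = 0"
  by (simp add: log_mean_def pmean_same)

lemma exp_log_mean: "exp (log_mean r u) = pmean (ereal r) (exp u) 1"
  unfolding log_mean_def by (simp add: pmean_pos)

lemma log_mean_has_derivative:
  "(log_mean r has_real_derivative (1 + tanh (r * u / 2)) / 2) (at u)"
proof (cases "r = 0")
  case True
  have "log_mean r = (\<lambda>u. u / 2)"
    by (rule ext) (simp add: log_mean_def pmean_real True ln_sqrt)
  then show ?thesis using True by (auto intro!: derivative_eq_intros)
next
  case False
  have *: "log_mean r = (\<lambda>u. ln ((exp (r * u) + 1) / 2) / r)"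
  proof
    fix u :: real
    have "0 < exp (r * u) + 1" by (simp add: add_pos_pos)
    then show "log_mean r u = ln ((exp (r * u) + 1) / 2) / r"
      using False by (simp add: log_mean_def pmean_real ln_powr powr_def mult.commute)
  qed
  have pos: "0 < exp (r * u) + 1" by (simp add: add_pos_pos)
  have "tanh (r * u / 2) = (1 - exp (- (r * u))) / (1 + exp (- (r * u)))"
    using tanh_real_altdef[of "r * u / 2"] by simp
  also have "\<dots> = (exp (r * u) - 1) / (exp (r * u) + 1)"
    using pos by (simp add: exp_minus divide_simps)
  finally have "tanh (r * u / 2) = (exp (r * u) - 1) / (exp (r * u) + 1)" .
  then have "(1 + tanh (r * u / 2)) / 2 = exp (r * u) / (exp (r * u) + 1)"
    using pos by (simp add: field_simps)
  moreover have "(log_mean r has_real_derivative exp (r * u) / (exp (r * u) + 1)) (at u)"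
    unfolding * using pos False
    by (auto intro!: derivative_eq_intros simp: divide_simps)
  ultimately show ?thesis by metis
qed

text \<open>
  The slope of \<open>tanh\<close> is \<open>1 - tanh\<^sup>2\<close>. It is at most \<open>1\<close>, hence \<open>\<bar>tanh x\<bar> \<le> \<bar>x\<bar>\<close>, and this in
  turn bounds the slope from below.
\<close>

lemma tanh_diff_le:
  fixes a b :: real
  assumes "a \<le> b"
  shows "tanh b - tanh a \<le> b - a"
proof -
  have "a - tanh a \<le> b - tanh b"
  proof (rule DERIV_nonneg_imp_nondecreasing[OF assms])
    fix x :: real
    have "((\<lambda>x. x - tanh x) has_real_derivative (tanh x)\<^sup>2) (at x)"
      by (auto intro!: derivative_eq_intros)
    then show "\<exists>y. ((\<lambda>x. x - tanh x) has_real_derivative y) (at x) \<and> 0 \<le> y" by force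
  qed
  then show ?thesis by simp
qed

lemma abs_tanh_le: "\<bar>tanh x\<bar> \<le> \<bar>x\<bar>" for x :: real
  using tanh_diff_le[of 0 x] tanh_diff_le[of x 0] by (cases "x \<ge> 0") auto

lemma tanh_diff_ge:
  fixes a b :: real
  assumes "a \<le> b" "\<bar>a\<bar> \<le> M" "\<bar>b\<bar> \<le> M"
  shows "(b - a) * (1 - M\<^sup>2) \<le> tanh b - tanh a"
proof -
  have "tanh a - a * (1 - M\<^sup>2) \<le> tanh b - b * (1 - M\<^sup>2)"
  proof (rule DERIV_nonneg_imp_nondecreasing[OF assms(1)])
    fix x :: real
    assume x: "a \<le> x" "x \<le> b"
    have "\<bar>tanh x\<bar> \<le> M" using abs_tanh_le[of x] assms x by linarith
    then have "(tanh x)\<^sup>2 \<le> M\<^sup>2" by (metis abs_ge_zero power2_abs power_mono)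
    moreover have "((\<lambda>x. tanh x - x * (1 - M\<^sup>2)) has_real_derivative M\<^sup>2 - (tanh x)\<^sup>2) (at x)"
      by (auto intro!: derivative_eq_intros)
    ultimately show "\<exists>y. ((\<lambda>x. tanh x - x * (1 - M\<^sup>2)) has_real_derivative y) (at x) \<and> 0 \<le> y"
      by (metis diff_ge_0_iff_ge)
  qed
  then show ?thesis by (simp add: algebra_simps)
qed

lemma log_mean_diff_derivative:
  "((\<lambda>u. log_mean q u - log_mean p u) has_real_derivative (tanh (q * u / 2) - tanh (p * u / 2)) / 2) (at u)"
  by (auto intro!: derivative_eq_intros log_mean_has_derivative simp: field_simps)

lemma log_mean_diff_strict_mono:
  assumes "p < q" "0 \<le> u" "u < v"
  shows "log_mean q u - log_mean p u < log_mean q v - log_mean p v"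
proof (rule DERIV_pos_imp_increasing_open[OF assms(3)])
  fix x assume "u < x" "x < v"
  then have "tanh (p * x / 2) < tanh (q * x / 2)" using assms by simp
  then show "\<exists>y. ((\<lambda>u. log_mean q u - log_mean p u) has_real_derivative y) (at x) \<and> y > 0"
    using log_mean_diff_derivative by force
next
  show "continuous_on {u..v} (\<lambda>u. log_mean q u - log_mean p u)"
    by (intro continuous_at_imp_continuous_on ballI DERIV_isCont[OF log_mean_diff_derivative])
qed

text \<open>
  The difference of the two logarithms vanishes at \<open>0\<close>. The slope bounds for \<open>tanh\<close>, applied to its
  derivative and integrated from \<open>0\<close> to \<open>u\<close>, give this estimate and the next one.
\<close>

lemma log_mean_diff_le:
  assumes "p \<le> q" "0 \<le> u"
  shows "log_mean q u - log_mean p u \<le> (q - p) * u\<^sup>2 / 8"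
proof -
  define F where "F = (\<lambda>u. (q - p) * u\<^sup>2 / 8 - (log_mean q u - log_mean p u))"
  have "F 0 \<le> F u"
  proof (rule DERIV_nonneg_imp_nondecreasing[OF assms(2)])
    fix x :: real assume "0 \<le> x"
    then have "tanh (q * x / 2) - tanh (p * x / 2) \<le> q * x / 2 - p * x / 2"
      using assms by (intro tanh_diff_le) (simp add: mult_right_mono)
    then have nonneg: "0 \<le> (q - p) * x / 4 - (tanh (q * x / 2) - tanh (p * x / 2)) / 2"
      by (simp add: left_diff_distrib)
    have "((\<lambda>u. (q - p) * u\<^sup>2 / 8) has_real_derivative (q - p) * x / 4) (at x)"
      by (auto intro!: derivative_eq_intros)
    then have "(F has_real_derivative (q - p) * x / 4 - (tanh (q * x / 2) - tanh (p * x / 2)) / 2) (at x)"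
      unfolding F_def by (rule DERIV_diff[OF _ log_mean_diff_derivative])
    with nonneg show "\<exists>y. (F has_real_derivative y) (at x) \<and> 0 \<le> y"
      by (intro exI[where x = "(q - p) * x / 4 - (tanh (q * x / 2) - tanh (p * x / 2)) / 2"] conjI)
  qed
  then show ?thesis by (simp add: F_def)
qed

lemma log_mean_diff_ge:
  assumes "p \<le> q" "\<bar>p\<bar> \<le> P" "\<bar>q\<bar> \<le> P" "0 \<le> u"
  shows "(q - p) * (u\<^sup>2 / 8 - P\<^sup>2 * u ^ 4 / 64) \<le> log_mean q u - log_mean p u"
proof -
  define F where "F = (\<lambda>u. log_mean q u - log_mean p u - (q - p) * (u\<^sup>2 / 8 - P\<^sup>2 * u ^ 4 / 64))"
  have "F 0 \<le> F u"
  proof (rule DERIV_nonneg_imp_nondecreasing[OF assms(4)])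
    fix x :: real assume x: "0 \<le> x"
    have "p * x \<le> q * x" using assms x by (intro mult_right_mono)
    moreover have "\<bar>p\<bar> * x \<le> P * x" "\<bar>q\<bar> * x \<le> P * x" using assms x by (auto intro: mult_right_mono)
    ultimately have "(q * x / 2 - p * x / 2) * (1 - (P * x / 2)\<^sup>2) \<le> tanh (q * x / 2) - tanh (p * x / 2)"
      using x by (intro tanh_diff_ge) (simp_all add: abs_mult)
    moreover have "(q - p) * (x / 4 - P\<^sup>2 * x ^ 3 / 16) = (q * x / 2 - p * x / 2) * (1 - (P * x / 2)\<^sup>2) / 2"
      by (simp add: power2_eq_square power3_eq_cube field_simps)
    ultimately have nonneg: "0 \<le> (tanh (q * x / 2) - tanh (p * x / 2)) / 2 - (q - p) * (x / 4 - P\<^sup>2 * x ^ 3 / 16)"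
      by simp
    have "((\<lambda>u. (q - p) * (u\<^sup>2 / 8 - P\<^sup>2 * u ^ 4 / 64)) has_real_derivative
        (q - p) * (x / 4 - P\<^sup>2 * x ^ 3 / 16)) (at x)"
      by (auto intro!: derivative_eq_intros)
    then have "(F has_real_derivative (tanh (q * x / 2) - tanh (p * x / 2)) / 2
        - (q - p) * (x / 4 - P\<^sup>2 * x ^ 3 / 16)) (at x)"
      unfolding F_def by (rule DERIV_diff[OF log_mean_diff_derivative])
    with nonneg show "\<exists>y. (F has_real_derivative y) (at x) \<and> 0 \<le> y"
      by (intro exI[where x = "(tanh (q * x / 2) - tanh (p * x / 2)) / 2
        - (q - p) * (x / 4 - P\<^sup>2 * x ^ 3 / 16)"] conjI)
  qed
  then show ?thesis by (simp add: F_def)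
qed

lemma pmean_ratio_exp:
  assumes "0 < x"
  shows "pmean (ereal q) x 1 / pmean (ereal p) x 1 = exp (log_mean q (ln x) - log_mean p (ln x))"
  using assms by (simp add: exp_diff exp_log_mean)

lemma pmean_ratio_strict_mono:
  assumes "p < q" "1 \<le> x" "x < y"
  shows "pmean (ereal q) x 1 / pmean (ereal p) x 1 < pmean (ereal q) y 1 / pmean (ereal p) y 1"
  using assms log_mean_diff_strict_mono[of p q "ln x" "ln y"] by (simp add: pmean_ratio_exp)

lemma ln_add_one_ge_quadratic:
  fixes z :: real
  assumes "0 \<le> z"
  shows "z - z\<^sup>2 / 2 \<le> ln (1 + z)"
proof -
  have "ln (1 + 0) - (0 - 0\<^sup>2 / 2) \<le> ln (1 + z) - (z - z\<^sup>2 / 2)"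
  proof (rule DERIV_nonneg_imp_nondecreasing[OF assms])
    fix x :: real assume x: "0 \<le> x"
    have "((\<lambda>x. ln (1 + x) - (x - x\<^sup>2 / 2)) has_real_derivative x\<^sup>2 / (1 + x)) (at x)"
      using x by (auto intro!: derivative_eq_intros simp: field_simps power2_eq_square)
    then show "\<exists>y. ((\<lambda>x. ln (1 + x) - (x - x\<^sup>2 / 2)) has_real_derivative y) (at x) \<and> 0 \<le> y"
      using x by (meson add_nonneg_nonneg divide_nonneg_nonneg zero_le_one zero_le_power2)
  qed
  then show ?thesis by simp
qed

text \<open>
  The factor \<open>1 - \<delta>\<close> absorbs all corrections to the leading term \<open>(q - p) z\<^sup>2 / 8\<close>: replacing \<open>z\<close> by
  \<open>u = ln (1 + z)\<close> costs a factor \<open>1 - z\<close>, the fourth order term in \<open>u\<close> costs a factor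
  \<open>1 - P z / 8\<close>, and \<open>z + P z / 8\<close> is at most \<open>(P + 3/2) z\<close>. The exponential is bounded
  below by its tangent.
\<close>

lemma pmean_ratio_ge:
  assumes "p < q" "\<bar>p\<bar> \<le> P" "\<bar>q\<bar> \<le> P" "0 \<le> z" "(P + 3 / 2) * z \<le> \<delta>" "\<delta> < 1"
  shows "1 + (1 - \<delta>) * (q - p) * z\<^sup>2 / 8 \<le> pmean (ereal q) (1 + z) 1 / pmean (ereal p) (1 + z) 1"
proof -
  define u where "u = ln (1 + z)"
  have P: "0 \<le> P" using assms by linarith
  have "0 \<le> P * z" using P assms by simp
  moreover have "P * z + 3 / 2 * z \<le> \<delta>" using assms by (simp add: algebra_simps)
  ultimately have Pz: "0 \<le> P * z" "P * z \<le> 1" "z \<le> 1" using assms by linarith+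
  have u: "z - z\<^sup>2 / 2 \<le> u" "u \<le> z" "0 \<le> u"
    using ln_add_one_ge_quadratic[of z] assms ln_add_one_self_le_self[of z] unfolding u_def by auto
  have "z\<^sup>2 * (1 - z) \<le> (z - z\<^sup>2 / 2)\<^sup>2"
    using zero_le_power2[of "z\<^sup>2"] by (simp add: power2_eq_square algebra_simps)
  also have "\<dots> \<le> u\<^sup>2"
  proof (rule power_mono[OF u(1)])
    have "z * z \<le> z * 1" using Pz assms by (intro mult_left_mono) auto
    then show "0 \<le> z - z\<^sup>2 / 2" using assms by (simp add: power2_eq_square)
  qed
  finally have u2: "z\<^sup>2 * (1 - z) \<le> u\<^sup>2" .
  \<comment> \<open>the hypothesis on \<open>z\<close> forces \<open>P z \<le> 1\<close>, so the quadratic correction is already dominated by a linear one\<close>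
  have "(P * u)\<^sup>2 \<le> (P * z)\<^sup>2" using P u by (intro power_mono mult_left_mono) auto
  also have "\<dots> \<le> P * z * 1" unfolding power2_eq_square using Pz by (intro mult_left_mono) auto
  finally have Pu: "(P * u)\<^sup>2 \<le> P * z" by simp
  have "(1 - \<delta>) * z\<^sup>2 \<le> z\<^sup>2 * ((1 - z) * (1 - P * z / 8))"
  proof -
    have "0 \<le> z * (P * z / 8)" using assms Pz by (intro mult_nonneg_nonneg) auto
    moreover have "(1 - z) * (1 - P * z / 8) = 1 - z - P * z / 8 + z * (P * z / 8)"
      by (simp add: field_simps)
    moreover have "P * z + 3 / 2 * z \<le> \<delta>" using assms by (simp add: algebra_simps)
    ultimately have "1 - \<delta> \<le> (1 - z) * (1 - P * z / 8)" using assms Pz by linarith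
    then show ?thesis by (metis mult.commute mult_right_mono zero_le_power2)
  qed
  also have "\<dots> = z\<^sup>2 * (1 - z) * (1 - P * z / 8)" by simp
  also have "\<dots> \<le> u\<^sup>2 * (1 - (P * u)\<^sup>2 / 8)"
    using u2 Pu Pz by (intro mult_mono) auto
  finally have key: "(1 - \<delta>) * z\<^sup>2 \<le> u\<^sup>2 * (1 - (P * u)\<^sup>2 / 8)" .
  have "(1 - \<delta>) * (q - p) * z\<^sup>2 / 8 = (q - p) * ((1 - \<delta>) * z\<^sup>2 / 8)" by simp
  also have "\<dots> \<le> (q - p) * (u\<^sup>2 * (1 - (P * u)\<^sup>2 / 8) / 8)"
    using key assms(1) by (intro mult_left_mono) auto
  also have "\<dots> = (q - p) * (u\<^sup>2 / 8 - P\<^sup>2 * u ^ 4 / 64)"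
    by (simp add: power2_eq_square power4_eq_xxxx field_simps)
  also have "\<dots> \<le> log_mean q u - log_mean p u"
    using assms u by (intro log_mean_diff_ge) auto
  finally have "1 + (1 - \<delta>) * (q - p) * z\<^sup>2 / 8 \<le> exp (log_mean q u - log_mean p u)"
    using exp_ge_add_one_self[of "log_mean q u - log_mean p u"] by linarith
  then show ?thesis using assms by (simp add: pmean_ratio_exp u_def)
qed

text \<open>
  With \<open>a = (q - p) / 8\<close> the ratio is at most \<open>exp (a u\<^sup>2)\<close>, which is too weak for large \<open>a\<close>, but it
  is also at most \<open>c = exp u\<close>. Both bounds lead to \<open>1 + a u (c - 1)\<close>: if \<open>a u \<le> 1\<close>, the number
  \<open>a u\<^sup>2\<close> is a convex combination of \<open>0\<close> and \<open>u\<close>, and \<open>exp\<close> is convex; if \<open>a u \<ge> 1\<close>, it exceeds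
  the second bound. It remains to use \<open>u \<le> c - 1\<close>.
\<close>

lemma pmean_ratio_le:
  assumes "p < q" "1 \<le> c"
  shows "pmean (ereal q) c 1 / pmean (ereal p) c 1 \<le> 1 + (q - p) * (c - 1)\<^sup>2 / 8"
proof -
  define u where "u = ln c"
  define a where "a = (q - p) / 8"
  have u: "0 \<le> u" "exp u = c" using assms by (auto simp: u_def)
  have uc: "u \<le> c - 1" using exp_ge_add_one_self[of u] u by simp
  have a: "0 \<le> a" using assms by (simp add: a_def)
  have step: "a * u * (c - 1) \<le> a * (c - 1)\<^sup>2"
    using mult_left_mono[OF mult_right_mono[OF uc, of "c - 1"] a] assms
    by (simp add: power2_eq_square mult.assoc)
  have "pmean (ereal q) c 1 / pmean (ereal p) c 1 \<le> 1 + a * u * (c - 1)"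
  proof (cases "a * u \<le> 1")
    case True
    have "pmean (ereal q) c 1 / pmean (ereal p) c 1 = exp (log_mean q u - log_mean p u)"
      using assms by (simp add: pmean_ratio_exp u_def)
    also have "\<dots> \<le> exp ((1 - a * u) *\<^sub>R 0 + (a * u) *\<^sub>R u)"
      using log_mean_diff_le[of p q u] assms u by (simp add: a_def power2_eq_square)
    also have "\<dots> \<le> (1 - a * u) * exp 0 + (a * u) * exp u"
      using exp_convex True a u by (intro convex_onD) auto
    finally show ?thesis using u by (simp add: algebra_simps)
  next
    case False
    have "pmean (ereal q) c 1 \<le> c" "1 \<le> pmean (ereal p) c 1"
      using pmean_le_max[of c 1 q] min_le_pmean[of c 1 p] assms by auto
    then have "pmean (ereal q) c 1 / pmean (ereal p) c 1 \<le> c / 1"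
      using assms by (intro frac_le) auto
    moreover have "1 * (c - 1) \<le> a * u * (c - 1)"
      using False assms by (intro mult_right_mono) auto
    ultimately show ?thesis by simp
  qed
  with step show ?thesis by (simp add: a_def)
qed

text \<open>
  The comparison function is the logarithm of the geometric mean, so this is a case of the estimates
  for the difference of two exponents.
\<close>

lemma log_mean_near_half:
  assumes "0 \<le> u"
  shows "\<bar>log_mean s u - u / 2\<bar> \<le> \<bar>s\<bar> * u\<^sup>2 / 8"
proof -
  have 0: "log_mean 0 u = u / 2"
    by (simp add: log_mean_def pmean_real ln_sqrt)
  have mono: "0 \<le> log_mean b u - log_mean a u" if "a \<le> b" for a b
    using that assms log_mean_diff_strict_mono[of a b 0 u] by (cases "a = b"; cases "u = 0") auto
  show ?thesis
  proof (cases "0 \<le> s")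
    case True
    then show ?thesis using mono[of 0 s] log_mean_diff_le[of 0 s u] assms 0 by simp
  next
    case False
    then show ?thesis using mono[of s 0] log_mean_diff_le[of s 0 u] assms 0 by simp
  qed
qed

lemma log_mean_strict_mono: "u < v \<Longrightarrow> log_mean s u < log_mean s v"
proof (erule DERIV_pos_imp_increasing)
  fix x
  have "0 < (1 + tanh (s * x / 2)) / 2" using tanh_real_gt_neg1[of "s * x / 2"] by simp
  then show "\<exists>y. (log_mean s has_real_derivative y) (at x) \<and> y > 0"
    using log_mean_has_derivative by blast
qed

text \<open>
  With \<open>u = ln R\<close> and \<open>v = ln (1 + \<epsilon>)\<close> the claim is \<open>u = 2 v\<close> up to second order. The bound \<open>\<epsilon>\<^sub>0\<close> is
  the value of \<open>\<epsilon>\<close> at \<open>u = u\<^sub>0\<close>; by monotonicity it keeps \<open>u\<close> below \<open>u\<^sub>0\<close>, where \<open>v \<ge> u / 4\<close>,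
  and therefore second order in \<open>u\<close> is second order in \<open>\<epsilon>\<close>.
\<close>

lemma pmean_expansion_at_one:
  "\<exists>C>0. \<exists>\<epsilon>\<^sub>0>0. \<forall>R\<ge>1. pmean (ereal s) R 1 - 1 \<le> \<epsilon>\<^sub>0 \<longrightarrow>
     \<bar>R - 1 - 2 * (pmean (ereal s) R 1 - 1)\<bar> \<le> C * (pmean (ereal s) R 1 - 1)\<^sup>2"
proof -
  \<comment> \<open>small enough that the quadratic error \<open>\<bar>s\<bar> u\<^sup>2 / 8\<close> is at most \<open>u / 8\<close>\<close>
  define u\<^sub>0 where "u\<^sub>0 = 1 / (\<bar>s\<bar> + 1)"
  have u0: "0 < u\<^sub>0" "u\<^sub>0 \<le> 1" "\<bar>s\<bar> * u\<^sub>0 \<le> 1" by (auto simp: u\<^sub>0_def field_simps)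
  define \<epsilon>\<^sub>0 where "\<epsilon>\<^sub>0 = exp (log_mean s u\<^sub>0) - 1"
  have "log_mean s 0 < log_mean s u\<^sub>0" using u0 by (intro log_mean_strict_mono)
  then have "0 < \<epsilon>\<^sub>0" by (simp add: \<epsilon>\<^sub>0_def)
  moreover have "\<bar>R - 1 - 2 * (pmean (ereal s) R 1 - 1)\<bar> \<le> (18 + 4 * \<bar>s\<bar>) * (pmean (ereal s) R 1 - 1)\<^sup>2"
    if R: "1 \<le> R" and small: "pmean (ereal s) R 1 - 1 \<le> \<epsilon>\<^sub>0" for R
  proof -
    define u where "u = ln R"
    define v where "v = log_mean s u"
    define \<epsilon> where "\<epsilon> = pmean (ereal s) R 1 - 1"
    have u: "0 \<le> u" "exp u = R" using R by (auto simp: u_def)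
    have v: "exp v = 1 + \<epsilon>" using u by (simp add: v_def exp_log_mean \<epsilon>_def)
    have "exp v \<le> exp (log_mean s u\<^sub>0)" using small v by (simp add: \<epsilon>\<^sub>0_def \<epsilon>_def)
    then have "u \<le> u\<^sub>0" using log_mean_strict_mono[of u\<^sub>0 u s] by (auto simp: v_def not_le[symmetric])
    then have u1: "u \<le> 1" using u0 by simp
    have "\<bar>s\<bar> * u \<le> \<bar>s\<bar> * u\<^sub>0" using \<open>u \<le> u\<^sub>0\<close> by (intro mult_left_mono) auto
    then have "\<bar>s\<bar> * u \<le> 1" using u0 by simp
    then have "\<bar>s\<bar> * u * u \<le> 1 * u" using u by (intro mult_right_mono) auto
    then have su: "\<bar>s\<bar> * u\<^sup>2 \<le> u" by (simp add: power2_eq_square mult.assoc)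
    have near: "\<bar>v - u / 2\<bar> \<le> \<bar>s\<bar> * u\<^sup>2 / 8" unfolding v_def by (rule log_mean_near_half[OF u(1)])
    then have v4: "u / 4 \<le> v" "v \<le> 1" using su u u1 by linarith+
    have v0: "0 \<le> v" using v4 u by simp
    have v\<epsilon>: "v \<le> \<epsilon>" using exp_ge_add_one_self[of v] v by simp
    have uu: "\<bar>R - 1 - u\<bar> \<le> u\<^sup>2" using exp_bound[OF u(1) u1] exp_ge_add_one_self[of u] u by simp
    have vv: "\<bar>\<epsilon> - v\<bar> \<le> v\<^sup>2" using exp_bound[OF v0 v4(2)] exp_ge_add_one_self[of v] v by simp
    have u2: "u\<^sup>2 \<le> 16 * \<epsilon>\<^sup>2" using power_mono[of u "4 * \<epsilon>" 2] u v4 v\<epsilon> by (simp add: power_mult_distrib)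
    have v2: "v\<^sup>2 \<le> \<epsilon>\<^sup>2" using v0 v\<epsilon> by (intro power_mono) auto
    have "\<bar>R - 1 - 2 * \<epsilon>\<bar> \<le> u\<^sup>2 + 2 * v\<^sup>2 + \<bar>s\<bar> * u\<^sup>2 / 4" using uu vv near by linarith
    also have "\<dots> \<le> 16 * \<epsilon>\<^sup>2 + 2 * \<epsilon>\<^sup>2 + \<bar>s\<bar> * (16 * \<epsilon>\<^sup>2) / 4"
      using u2 v2 mult_left_mono[OF u2, of "\<bar>s\<bar>"] by simp
    finally show ?thesis by (simp add: \<epsilon>_def algebra_simps)
  qed
  moreover have "0 < 18 + 4 * \<bar>s\<bar>" by simp
  ultimately show ?thesis by blast
qed

section \<open>Euclidean space as a space of sequences\<close>

lemma scaleR_fun_apply [simp]: "(c *\<^sub>R x) i = c * x i" for x :: "'a \<Rightarrow> real"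
  by (simp add: scaleR_fun_def)

lemma minus_fun_apply [simp]: "(x - y) i = x i - y i" for x y :: "'a \<Rightarrow> real"
  by (simp add: fun_diff_def)

lemma plus_fun_apply [simp]: "(x + y) i = x i + y i" for x y :: "'a \<Rightarrow> real"
  by (simp add: plus_fun_def)

lemma dotp_scaleR_right [simp]: "dotp n a (c *\<^sub>R x) = c * dotp n a x"
  by (simp add: dotp_def sum_distrib_left mult_ac)

lemma dotp_scaleR_left [simp]: "dotp n (c *\<^sub>R a) x = c * dotp n a x"
  by (simp add: dotp_def sum_distrib_left mult_ac)

lemma dotp_add_right: "dotp n a (x + y) = dotp n a x + dotp n a y"
  by (simp add: dotp_def sum.distrib algebra_simps)

lemma dotp_diff_right: "dotp n a (x - y) = dotp n a x - dotp n a y"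
  by (simp add: dotp_def sum_subtractf algebra_simps)

lemma dotp_commute: "dotp n a x = dotp n x a"
  by (simp add: dotp_def mult.commute)

lemma dotp_self: "dotp n x x = (L2_set x {..<n})\<^sup>2"
  by (simp add: dotp_def L2_set_def sum_nonneg power2_eq_square)

lemma L2_set_scaleR: "L2_set (c *\<^sub>R x) A = \<bar>c\<bar> * L2_set x A"
proof -
  have "(\<Sum>i\<in>A. ((c *\<^sub>R x) i)\<^sup>2) = c\<^sup>2 * (\<Sum>i\<in>A. (x i)\<^sup>2)"
    by (simp add: power_mult_distrib sum_distrib_left)
  then show ?thesis by (simp add: L2_set_def real_sqrt_mult)
qed

lemma scaleR_mem_Euclidean_space:
  "x \<in> topspace (Euclidean_space n) \<Longrightarrow> c *\<^sub>R x \<in> topspace (Euclidean_space n)"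
  by (simp add: topspace_Euclidean_space)

lemma L2_set_pos:
  assumes "x \<in> topspace (Euclidean_space n)" "x \<noteq> 0"
  shows "0 < L2_set x {..<n}"
proof -
  obtain i where "x i \<noteq> 0" using assms(2) by (auto simp: fun_eq_iff)
  then have "i < n" using assms(1) by (auto simp: topspace_Euclidean_space not_less[symmetric])
  then have "L2_set x {..<n} \<noteq> 0" using \<open>x i \<noteq> 0\<close> by (simp add: L2_set_eq_0_iff) blast
  then show ?thesis using L2_set_nonneg[of x "{..<n}"] by linarith
qed

lemma normalize_mem_unit_sphere:
  assumes "x \<in> topspace (Euclidean_space n)" "x \<noteq> 0"
  shows "(1 / L2_set x {..<n}) *\<^sub>R x \<in> unit_sphere n"
  using L2_set_pos[OF assms] assms(1)
  by (simp add: unit_sphere_def scaleR_mem_Euclidean_space L2_set_scaleR)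

lemma unit_sphereD:
  assumes "v \<in> unit_sphere n"
  shows "v \<in> topspace (Euclidean_space n)" "v \<noteq> 0"
  using assms by (auto simp: unit_sphere_def L2_set_def)

lemma unit_sphere_nonempty:
  assumes "1 \<le> n"
  obtains a where "a \<in> unit_sphere n"
proof -
  have "(\<Sum>i<n. (if i = 0 then 1 else 0 :: real)\<^sup>2) = (\<Sum>i<n. if i = 0 then 1 else 0)"
    by (intro sum.cong) auto
  also have "\<dots> = 1" using assms by simp
  finally have "(\<lambda>i. if i = 0 then 1 else 0) \<in> unit_sphere n"
    using assms by (auto simp: unit_sphere_def topspace_Euclidean_space L2_set_def)
  then show thesis by (rule that)
qed

text \<open>
  This transfers compactness to the product topology on the type of sequences, where the results
  on continuous functions apply directly.
\<close>

lemma compactin_Euclidean_space_iff: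
  "compactin (Euclidean_space n) S \<longleftrightarrow> compact S \<and> S \<subseteq> topspace (Euclidean_space n)"
  by (auto simp: Euclidean_space_def euclidean_product_topology compactin_subtopology)

lemma continuous_on_dotp:
  fixes f g :: "'b::topological_space \<Rightarrow> nat \<Rightarrow> real"
  assumes "continuous_on S f" "continuous_on S g"
  shows "continuous_on S (\<lambda>y. dotp n (f y) (g y))"
  unfolding dotp_def
  by (intro continuous_on_sum continuous_on_mult)
    (rule continuous_on_product_then_coordinatewise, rule assms)+

text \<open>
  The functional is the normalised difference between \<open>x\<close> and its nearest point \<open>y\<^sub>0\<close> in \<open>S\<close>. Because
  \<open>y\<^sub>0\<close> maximises it on \<open>S\<close>, the separation is strict also for the support function of \<open>S\<close>.
\<close>

lemma separating_functional:
  assumes S: "compact S" "convex S" "S \<noteq> {}" "S \<subseteq> topspace (Euclidean_space n)"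
    and x: "x \<in> topspace (Euclidean_space n)" "x \<notin> S"
  obtains a y\<^sub>0 where "a \<in> unit_sphere n" "y\<^sub>0 \<in> S" "\<And>y. y \<in> S \<Longrightarrow> dotp n a y \<le> dotp n a y\<^sub>0"
    "dotp n a y\<^sub>0 < dotp n a x"
proof -
  have "continuous_on S (\<lambda>y. dotp n (x - y) (x - y))"
    unfolding fun_diff_def
    by (intro continuous_on_dotp continuous_on_coordinatewise_then_product continuous_on_diff
        continuous_on_const) (rule continuous_on_product_then_coordinatewise, rule continuous_on_id)+
  then obtain y\<^sub>0 where y0: "y\<^sub>0 \<in> S"
    and min: "\<And>y. y \<in> S \<Longrightarrow> dotp n (x - y\<^sub>0) (x - y\<^sub>0) \<le> dotp n (x - y) (x - y)"
    using continuous_attains_inf[OF S(1,3)] by blast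
  define w where "w = x - y\<^sub>0"
  have w: "w \<in> topspace (Euclidean_space n)" "w \<noteq> 0"
    using x y0 S(4) by (auto simp: w_def topspace_Euclidean_space)
  have obtuse: "dotp n w y \<le> dotp n w y\<^sub>0" if "y \<in> S" for y
  proof (rule ccontr)
    assume less: "\<not> ?thesis"
    define d where "d = y - y\<^sub>0"
    have wd: "0 < dotp n w d" using less by (simp add: d_def dotp_diff_right)
    have step: "2 * dotp n w d \<le> s * dotp n d d" if s: "0 < s" "s \<le> 1" for s
    proof -
      have "(1 - s) *\<^sub>R y\<^sub>0 + s *\<^sub>R y \<in> S"
        using s S(2) y0 \<open>y \<in> S\<close> by (intro convexD) auto
      moreover have "x - ((1 - s) *\<^sub>R y\<^sub>0 + s *\<^sub>R y) = w - s *\<^sub>R d"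
        by (rule ext) (simp add: w_def d_def algebra_simps)
      ultimately have "dotp n w w \<le> dotp n (w - s *\<^sub>R d) (w - s *\<^sub>R d)"
        using min by (metis w_def)
      also have "\<dots> = dotp n w w - 2 * s * dotp n w d + s * s * dotp n d d"
        by (simp add: algebra_simps dotp_diff_right dotp_commute[of n "w - s *\<^sub>R d"] dotp_commute[of n d w])
      finally have "s * (2 * dotp n w d) \<le> s * (s * dotp n d d)" by simp
      then show ?thesis using s by simp
    qed
    have dd: "0 < dotp n d d" using step[of 1] wd by linarith
    \<comment> \<open>moving from \<open>y\<^sub>0\<close> towards \<open>y\<close> by this fraction brings the point closer to \<open>x\<close>\<close>
    define s where "s = min 1 (dotp n w d / dotp n d d)"
    have "s * dotp n d d \<le> dotp n w d / dotp n d d * dotp n d d"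
      using dd by (intro mult_right_mono) (auto simp: s_def)
    moreover have "0 < s" "s \<le> 1" using wd dd by (auto simp: s_def)
    ultimately show False using step[of s] wd dd by simp
  qed
  define c where "c = 1 / L2_set w {..<n}"
  have c: "0 < c" using L2_set_pos[OF w] by (simp add: c_def)
  show thesis
  proof
    show "c *\<^sub>R w \<in> unit_sphere n" unfolding c_def by (rule normalize_mem_unit_sphere[OF w])
    show "dotp n (c *\<^sub>R w) y \<le> dotp n (c *\<^sub>R w) y\<^sub>0" if "y \<in> S" for y
      using obtuse[OF that] c by simp
    have "0 < dotp n w w" using L2_set_pos[OF w] by (simp add: dotp_self)
    also have "\<dots> = dotp n w x - dotp n w y\<^sub>0" using dotp_diff_right[of n w x y\<^sub>0] by (simp add: w_def)
    finally show "dotp n (c *\<^sub>R w) y\<^sub>0 < dotp n (c *\<^sub>R w) x" using c by simp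
  qed (rule y0)
qed

section \<open>Support and gauge functions of convex bodies\<close>

lemma dotp_le_support_fun:
  assumes "compact C" "x \<in> C"
  shows "dotp n a x \<le> support_fun n C a"
  unfolding support_fun_def
proof (rule cSup_upper)
  have "continuous_on C (\<lambda>y. dotp n a y)"
    by (intro continuous_on_dotp continuous_on_const continuous_on_id)
  then have "compact ((\<lambda>y. dotp n a y) ` C)" using assms(1) by (rule compact_continuous_image)
  then have "bdd_above ((\<lambda>y. dotp n a y) ` C)" by (intro bounded_imp_bdd_above compact_imp_bounded)
  then show "bdd_above {dotp n a x |x. x \<in> C}" by (simp add: Setcompr_eq_image)
qed (use assms in blast)

lemma support_fun_le:
  assumes "C \<noteq> {}" "\<And>x. x \<in> C \<Longrightarrow> dotp n a x \<le> b"
  shows "support_fun n C a \<le> b"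
  unfolding support_fun_def using assms by (intro cSup_least) auto

lemma convex_bodies0D:
  assumes "C \<in> convex_bodies0 n"
  shows "convex C" "compact C" "C \<subseteq> topspace (Euclidean_space n)" "0 \<in> C" "C \<noteq> {}"
  using assms interior_of_subset[of "Euclidean_space n" C]
  by (auto simp: convex_bodies0_def compactin_Euclidean_space_iff)

text \<open>
  A basic neighbourhood of the origin in the product topology restricts finitely many coordinates, which
  gives a common positive bound for the first \<open>n\<close> of them.
\<close>

lemma convex_bodies0_contains_ball:
  assumes "C \<in> convex_bodies0 n"
  obtains r where "0 < r" "\<And>x. x \<in> topspace (Euclidean_space n) \<Longrightarrow> L2_set x {..<n} \<le> r \<Longrightarrow> x \<in> C"
proof -
  obtain U where U: "openin (Euclidean_space n) U" "0 \<in> U" "U \<subseteq> C"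
    using assms by (auto simp: convex_bodies0_def interior_of_def)
  then obtain V where V: "openin (powertop_real UNIV) V" "U = V \<inter> {x. \<forall>i\<ge>n. x i = 0}"
    by (auto simp: Euclidean_space_def openin_subtopology)
  then have "0 \<in> V" using U by auto
  then obtain X where X: "(0 :: nat \<Rightarrow> real) \<in> Pi\<^sub>E UNIV X" "\<And>i. open (X i)" "finite {i. X i \<noteq> UNIV}"
      "Pi\<^sub>E UNIV X \<subseteq> V"
    using product_topology_open_contains_basis[OF V(1), of 0] by auto
  have "\<exists>e>0. \<forall>t. \<bar>t\<bar> < e \<longrightarrow> t \<in> X i" for i
  proof -
    have "0 \<in> X i" using X(1) by (auto simp: PiE_iff)
    then obtain e where "e > 0" "ball 0 e \<subseteq> X i" using X(2) open_contains_ball by blast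
    then show ?thesis by (auto simp: subset_iff)
  qed
  then obtain e where e: "\<And>i. 0 < e i" "\<And>i t. \<bar>t\<bar> < e i \<Longrightarrow> t \<in> X i" by metis
  define r where "r = Min (insert 1 (e ` {..<n})) / 2"
  have m: "0 < Min (insert 1 (e ` {..<n}))" using e(1) by (subst Min_gr_iff) auto
  show thesis
  proof
    show "0 < r" using m by (simp add: r_def)
    fix x assume x: "x \<in> topspace (Euclidean_space n)" "L2_set x {..<n} \<le> r"
    have "x i \<in> X i" for i
    proof (cases "i < n")
      case True
      have "\<bar>x i\<bar> \<le> L2_set (\<lambda>i. \<bar>x i\<bar>) {..<n}"
        using True by (intro member_le_L2_set) auto
      also have "\<dots> \<le> r" using x by (simp add: L2_set_def)
      also have "r < Min (insert 1 (e ` {..<n}))" using m by (simp add: r_def)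
      also have "\<dots> \<le> e i" using True by (intro Min_le) auto
      finally show ?thesis by (rule e(2))
    next
      case False
      then show ?thesis using x(1) e(2)[of 0 i] e(1)[of i] by (simp add: topspace_Euclidean_space)
    qed
    then have "x \<in> V" using X(4) by (auto simp: PiE_iff)
    then show "x \<in> C" using x(1) U V by (auto simp: topspace_Euclidean_space)
  qed
qed

lemma support_fun_pos:
  assumes C: "C \<in> convex_bodies0 n" and a: "a \<in> unit_sphere n"
  shows "0 < support_fun n C a"
proof -
  obtain r where r: "0 < r" "\<And>x. x \<in> topspace (Euclidean_space n) \<Longrightarrow> L2_set x {..<n} \<le> r \<Longrightarrow> x \<in> C"
    using convex_bodies0_contains_ball[OF C] by blast
  have "r *\<^sub>R a \<in> C"
    using a r by (intro r(2)) (auto simp: unit_sphere_def scaleR_mem_Euclidean_space L2_set_scaleR)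
  then have "dotp n a (r *\<^sub>R a) \<le> support_fun n C a"
    using dotp_le_support_fun convex_bodies0D(2)[OF C] by blast
  then show ?thesis using a r by (simp add: dotp_self unit_sphere_def)
qed

lemma mem_scaleR_image_iff:
  fixes x :: "'a::real_vector"
  assumes "0 < t"
  shows "x \<in> (*\<^sub>R) t ` C \<longleftrightarrow> (1 / t) *\<^sub>R x \<in> C"
proof
  assume "(1 / t) *\<^sub>R x \<in> C"
  then show "x \<in> (*\<^sub>R) t ` C" using assms by (intro image_eqI[of _ _ "(1 / t) *\<^sub>R x"]) auto
qed (use assms in auto)

lemma dotp_le_of_mem_scaleR:
  assumes "C \<in> convex_bodies0 n" "0 \<le> t" "x \<in> (*\<^sub>R) t ` C"
  shows "dotp n a x \<le> t * support_fun n C a"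
  using assms dotp_le_support_fun[OF convex_bodies0D(2)[OF assms(1)], of _ n a]
  by (auto intro!: mult_left_mono)

text \<open>
  This duality between a body and its support function turns membership in a multiple of the body into
  inequalities that are linear in \<open>t\<close>. These survive the infima in the definitions of the gauge
  function and the covering radius, so both infima are attained.
\<close>

lemma mem_scaleR_iff_dotp_le:
  assumes C: "C \<in> convex_bodies0 n" and t: "0 < t" and x: "x \<in> topspace (Euclidean_space n)"
  shows "x \<in> (*\<^sub>R) t ` C \<longleftrightarrow> (\<forall>a\<in>unit_sphere n. dotp n a x \<le> t * support_fun n C a)"
proof
  assume *: "\<forall>a\<in>unit_sphere n. dotp n a x \<le> t * support_fun n C a"
  show "x \<in> (*\<^sub>R) t ` C"
  proof (rule ccontr)
    assume "x \<notin> (*\<^sub>R) t ` C"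
    then have "(1 / t) *\<^sub>R x \<notin> C" using t by (simp add: mem_scaleR_image_iff)
    then obtain a y where a: "a \<in> unit_sphere n" and y: "\<And>z. z \<in> C \<Longrightarrow> dotp n a z \<le> dotp n a y"
        "dotp n a y < dotp n a ((1 / t) *\<^sub>R x)"
      using separating_functional[of C n "(1 / t) *\<^sub>R x"] convex_bodies0D[OF C]
        scaleR_mem_Euclidean_space[OF x] by metis
    have "support_fun n C a \<le> dotp n a y" using y(1) convex_bodies0D(5)[OF C] by (intro support_fun_le)
    also have "\<dots> < dotp n a x / t" using y(2) by simp
    finally show False using * a t by (auto simp: field_simps dest!: bspec[of _ _ a])
  qed
qed (use dotp_le_of_mem_scaleR[OF C] t in auto)

lemma support_fun_mono_scaleR:
  assumes K: "K \<in> convex_bodies0 n" and L: "L \<in> convex_bodies0 n" and "0 \<le> t" "K \<subseteq> (*\<^sub>R) t ` L"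
  shows "support_fun n K a \<le> t * support_fun n L a"
  using assms convex_bodies0D(5)[OF K] by (intro support_fun_le dotp_le_of_mem_scaleR) auto

lemma scaleR_image_mono:
  assumes L: "L \<in> convex_bodies0 n" and t: "0 \<le> s" "s \<le> t" "0 < t"
  shows "(*\<^sub>R) s ` L \<subseteq> (*\<^sub>R) t ` L"
proof
  fix x assume x: "x \<in> (*\<^sub>R) s ` L"
  then have "x \<in> topspace (Euclidean_space n)"
    using convex_bodies0D(3)[OF L] by (auto intro!: scaleR_mem_Euclidean_space)
  moreover have "dotp n a x \<le> t * support_fun n L a" if "a \<in> unit_sphere n" for a
    using dotp_le_of_mem_scaleR[OF L t(1) x, of a] mult_right_mono[OF t(2), of "support_fun n L a"]
      support_fun_pos[OF L that] by linarith
  ultimately show "x \<in> (*\<^sub>R) t ` L" using mem_scaleR_iff_dotp_le[OF L t(3)] by blast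
qed

lemma gauge_fun_le: "0 \<le> t \<Longrightarrow> x \<in> (*\<^sub>R) t ` C \<Longrightarrow> gauge_fun C x \<le> t"
  unfolding gauge_fun_def by (intro cInf_lower bdd_belowI[of _ 0]) auto

text \<open>
  For each direction \<open>a\<close>, the value at \<open>x\<close> is at most \<open>t\<close> times the support function for all \<open>t\<close> in the
  set whose infimum is the gauge, hence also for the infimum itself.
\<close>

lemma gauge_fun_attained:
  assumes C: "C \<in> convex_bodies0 n" and x: "x \<in> topspace (Euclidean_space n)" "x \<noteq> 0"
  shows "0 < gauge_fun C x" "x \<in> (*\<^sub>R) (gauge_fun C x) ` C"
proof -
  let ?S = "{t. 0 \<le> t \<and> x \<in> (*\<^sub>R) t ` C}"
  obtain r where r: "0 < r" "\<And>x. x \<in> topspace (Euclidean_space n) \<Longrightarrow> L2_set x {..<n} \<le> r \<Longrightarrow> x \<in> C"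
    using convex_bodies0_contains_ball[OF C] by blast
  define t where "t = L2_set x {..<n} / r"
  have t: "0 < t" using L2_set_pos[OF x] r by (simp add: t_def)
  have "(1 / t) *\<^sub>R x \<in> C"
    using r(1) x L2_set_pos[OF x]
    by (intro r(2)) (auto simp: scaleR_mem_Euclidean_space L2_set_scaleR t_def)
  then have ne: "?S \<noteq> {}" using t mem_scaleR_image_iff[OF t, of x C] by (auto intro!: exI[of _ t])
  have bound: "dotp n a x \<le> gauge_fun C x * support_fun n C a" if a: "a \<in> unit_sphere n" for a
  proof -
    have h: "0 < support_fun n C a" by (rule support_fun_pos[OF C a])
    have "dotp n a x / support_fun n C a \<le> gauge_fun C x"
      unfolding gauge_fun_def
    proof (rule cInf_greatest[OF ne])
      fix t assume "t \<in> ?S"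
      then show "dotp n a x / support_fun n C a \<le> t"
        using dotp_le_of_mem_scaleR[OF C, of t x a] h by (simp add: field_simps)
    qed
    then show ?thesis using h by (simp add: field_simps)
  qed
  define a where "a = (1 / L2_set x {..<n}) *\<^sub>R x"
  have a: "a \<in> unit_sphere n" unfolding a_def by (rule normalize_mem_unit_sphere[OF x])
  have "0 < dotp n a x" using L2_set_pos[OF x] by (simp add: a_def dotp_self)
  then have "0 < gauge_fun C x * support_fun n C a" using bound[OF a] by linarith
  then show g: "0 < gauge_fun C x" using support_fun_pos[OF C a] by (simp add: zero_less_mult_iff)
  show "x \<in> (*\<^sub>R) (gauge_fun C x) ` C" using mem_scaleR_iff_dotp_le[OF C g x(1)] bound by blast
qed

section \<open>Covering radius and covering distance\<close>

lemma cov_radius_le: "0 \<le> t \<Longrightarrow> K \<subseteq> (*\<^sub>R) t ` L \<Longrightarrow> cov_radius K L \<le> t"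
  unfolding cov_radius_def by (intro cInf_lower bdd_belowI[of _ 0]) auto

text \<open>
  The witness \<open>s\<close> is needed because the infimum of the empty set of reals is an unspecified number.
\<close>

lemma cov_radius_ge:
  assumes "0 \<le> s" "K \<subseteq> (*\<^sub>R) s ` L" "\<And>t. 0 \<le> t \<Longrightarrow> K \<subseteq> (*\<^sub>R) t ` L \<Longrightarrow> b \<le> t"
  shows "b \<le> cov_radius K L"
  unfolding cov_radius_def using assms by (intro cInf_greatest) auto

lemma convex_bodies0_absorbs:
  assumes K: "K \<in> convex_bodies0 n" and L: "L \<in> convex_bodies0 n"
  obtains t where "0 < t" "K \<subseteq> (*\<^sub>R) t ` L"
proof -
  obtain r where r: "0 < r" "\<And>x. x \<in> topspace (Euclidean_space n) \<Longrightarrow> L2_set x {..<n} \<le> r \<Longrightarrow> x \<in> L"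
    using convex_bodies0_contains_ball[OF L] by blast
  have "continuous_on K (\<lambda>x. dotp n x x)" by (intro continuous_on_dotp continuous_on_id)
  then have "compact ((\<lambda>x. dotp n x x) ` K)" using convex_bodies0D(2)[OF K] by (rule compact_continuous_image)
  then have "bounded ((\<lambda>x. dotp n x x) ` K)" by (rule compact_imp_bounded)
  then obtain B where B: "\<And>x. x \<in> K \<Longrightarrow> dotp n x x \<le> B"
    by (auto simp: bounded_iff abs_le_iff)
  define t where "t = (1 + \<bar>B\<bar>) / r"
  have t: "0 < t" using r by (simp add: t_def)
  have "K \<subseteq> (*\<^sub>R) t ` L"
  proof
    fix x assume x: "x \<in> K"
    have "(L2_set x {..<n})\<^sup>2 \<le> 1 + \<bar>B\<bar>" using B[OF x] by (simp add: dotp_self)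
    also have "\<dots> \<le> (1 + \<bar>B\<bar>)\<^sup>2" by (simp add: power2_eq_square algebra_simps)
    finally have "L2_set x {..<n} \<le> 1 + \<bar>B\<bar>" by (rule power2_le_imp_le) simp
    then have "r * L2_set x {..<n} \<le> r * (1 + \<bar>B\<bar>)" using r(1) by (intro mult_left_mono) auto
    then have "(1 / t) *\<^sub>R x \<in> L"
      using t r(1) x convex_bodies0D(3)[OF K]
      by (intro r(2) scaleR_mem_Euclidean_space) (auto simp: L2_set_scaleR t_def field_simps)
    then show "x \<in> (*\<^sub>R) t ` L" using t by (simp add: mem_scaleR_image_iff)
  qed
  with t show thesis by (rule that)
qed

text \<open>
  As for the gauge function, the infimum is attained because the inequality between the support
  functions passes to it.
\<close>

lemma cov_radius_attained:
  assumes K: "K \<in> convex_bodies0 n" and L: "L \<in> convex_bodies0 n" and n: "1 \<le> n"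
  shows "0 < cov_radius K L" "K \<subseteq> (*\<^sub>R) (cov_radius K L) ` L"
proof -
  obtain s where s: "0 < s" "K \<subseteq> (*\<^sub>R) s ` L" using convex_bodies0_absorbs[OF K L] by blast
  have bound: "support_fun n K a \<le> cov_radius K L * support_fun n L a" if a: "a \<in> unit_sphere n" for a
  proof -
    have h: "0 < support_fun n L a" by (rule support_fun_pos[OF L a])
    have "support_fun n K a / support_fun n L a \<le> cov_radius K L"
    proof (rule cov_radius_ge)
      fix t :: real assume "0 \<le> t" "K \<subseteq> (*\<^sub>R) t ` L"
      then show "support_fun n K a / support_fun n L a \<le> t"
        using support_fun_mono_scaleR[OF K L, of t a] h by (simp add: field_simps)
    qed (use s in auto)
    then show ?thesis using h by (simp add: field_simps)
  qed
  obtain a where a: "a \<in> unit_sphere n" using unit_sphere_nonempty[OF n] by blast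
  have "0 < cov_radius K L * support_fun n L a" using bound[OF a] support_fun_pos[OF K a] by linarith
  then show pos: "0 < cov_radius K L" using support_fun_pos[OF L a] by (simp add: zero_less_mult_iff)
  show "K \<subseteq> (*\<^sub>R) (cov_radius K L) ` L"
  proof
    fix x assume x: "x \<in> K"
    have "dotp n a x \<le> cov_radius K L * support_fun n L a" if "a \<in> unit_sphere n" for a
      using bound[OF that] dotp_le_support_fun[OF convex_bodies0D(2)[OF K] x, of n a] by linarith
    then show "x \<in> (*\<^sub>R) (cov_radius K L) ` L"
      using mem_scaleR_iff_dotp_le[OF L pos] x convex_bodies0D(3)[OF K] by blast
  qed
qed

text \<open>
  The bound \<open>1 \<le> cov_dist K L\<close> comes from going around once: \<open>K\<close> is contained in the square of the
  covering distance times \<open>K\<close>.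
\<close>

lemma cov_dist_attained:
  assumes K: "K \<in> convex_bodies0 n" and L: "L \<in> convex_bodies0 n" and n: "1 \<le> n"
  shows "K \<subseteq> (*\<^sub>R) (cov_dist K L) ` L" "L \<subseteq> (*\<^sub>R) (cov_dist K L) ` K" "1 \<le> cov_dist K L"
proof -
  have pos: "0 < cov_dist K L" using cov_radius_attained(1)[OF K L n] by (simp add: cov_dist_def)
  have le: "cov_radius K L \<le> cov_dist K L" "cov_radius L K \<le> cov_dist K L" by (simp_all add: cov_dist_def)
  show 1: "K \<subseteq> (*\<^sub>R) (cov_dist K L) ` L"
    using cov_radius_attained[OF K L n] scaleR_image_mono[OF L _ le(1) pos] by (meson less_imp_le subset_trans)
  show 2: "L \<subseteq> (*\<^sub>R) (cov_dist K L) ` K"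
    using cov_radius_attained[OF L K n] scaleR_image_mono[OF K _ le(2) pos] by (meson less_imp_le subset_trans)
  obtain a where a: "a \<in> unit_sphere n" using unit_sphere_nonempty[OF n] by blast
  have "support_fun n K a \<le> cov_dist K L * (cov_dist K L * support_fun n K a)"
    using support_fun_mono_scaleR[OF K L _ 1, of a] 
      mult_left_mono[OF support_fun_mono_scaleR[OF L K _ 2, of a], of "cov_dist K L"] pos by linarith
  then have "1 * support_fun n K a \<le> cov_dist K L * cov_dist K L * support_fun n K a" by (simp add: mult.assoc)
  then have "1 \<le> cov_dist K L * cov_dist K L"
    using support_fun_pos[OF K a] by (simp only: mult_le_cancel_right)
  then show "1 \<le> cov_dist K L" using pos mult_strict_mono[of "cov_dist K L" 1 "cov_dist K L" 1] by force
qed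

section \<open>The means of two convex bodies\<close>

lemma lower_mean_commute: "lower_mean n p K L = lower_mean n p L K"
  by (simp add: lower_mean_def pmean_commute)

lemma upper_mean_commute: "upper_mean n p K L = upper_mean n p L K"
  by (simp add: upper_mean_def pmean_commute)

lemma cov_dist_commute: "cov_dist K L = cov_dist L K"
  by (simp add: cov_dist_def max.commute)

lemma lower_mean_radial:
  assumes K: "K \<in> convex_bodies0 n" and L: "L \<in> convex_bodies0 n" and v: "v \<in> unit_sphere n"
  shows "0 < inverse (gauge_fun K v)" "0 < inverse (gauge_fun L v)"
    and "pmean p (inverse (gauge_fun K v)) (inverse (gauge_fun L v)) *\<^sub>R v \<in> lower_mean n p K L"
proof -
  show "0 < inverse (gauge_fun K v)" "0 < inverse (gauge_fun L v)"
    using gauge_fun_attained(1)[OF _ unit_sphereD[OF v]] K L by simp_all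
  show "pmean p (inverse (gauge_fun K v)) (inverse (gauge_fun L v)) *\<^sub>R v \<in> lower_mean n p K L"
    unfolding lower_mean_def by (rule hull_inc) (use v in blast)
qed

text \<open>
  The lower mean contains positive multiples of two antipodal unit vectors, hence the origin between
  them. So it is star-shaped, and a point may be replaced by a point further out on its ray.
\<close>

lemma zero_mem_lower_mean:
  assumes K: "K \<in> convex_bodies0 n" and L: "L \<in> convex_bodies0 n" and n: "1 \<le> n"
  shows "0 \<in> lower_mean n p K L"
proof -
  obtain v where v: "v \<in> unit_sphere n" using unit_sphere_nonempty[OF n] by blast
  then have v': "(- 1) *\<^sub>R v \<in> unit_sphere n"
    by (simp only: unit_sphere_def mem_Collect_eq scaleR_mem_Euclidean_space L2_set_scaleR) simp
  define s where "s = pmean p (inverse (gauge_fun K v)) (inverse (gauge_fun L v))"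
  define t where "t = pmean p (inverse (gauge_fun K ((- 1) *\<^sub>R v))) (inverse (gauge_fun L ((- 1) *\<^sub>R v)))"
  have pos: "0 < s" "0 < t"
    unfolding s_def t_def using lower_mean_radial(1,2)[OF K L] v v' pmean_pos by blast+
  have "(t / (s + t)) *\<^sub>R (s *\<^sub>R v) + (s / (s + t)) *\<^sub>R (t *\<^sub>R ((- 1) *\<^sub>R v)) \<in> lower_mean n p K L"
  proof (rule convexD)
    show "convex (lower_mean n p K L)" by (simp add: lower_mean_def)
    show "s *\<^sub>R v \<in> lower_mean n p K L" "t *\<^sub>R ((- 1) *\<^sub>R v) \<in> lower_mean n p K L"
      unfolding s_def t_def using lower_mean_radial(3)[OF K L] v v' by blast+
    show "t / (s + t) + s / (s + t) = 1"
      using pos by (simp add: add_divide_distrib[symmetric] add.commute)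
  qed (use pos in auto)
  also have "(t / (s + t)) *\<^sub>R (s *\<^sub>R v) + (s / (s + t)) *\<^sub>R (t *\<^sub>R ((- 1) *\<^sub>R v)) = 0"
    by (rule ext) simp
  finally show ?thesis .
qed

text \<open>
  The inverse gauge of \<open>K\<close> and \<open>L\<close> is how far these bodies reach on a ray. Points of \<open>K\<close> and \<open>L\<close> on
  the same ray bound it from below, and \<open>m\<^sub>p\<close> is monotone.
\<close>

lemma pmean_scaleR_mem_lower_mean:
  assumes K: "K \<in> convex_bodies0 n" and L: "L \<in> convex_bodies0 n" and n: "1 \<le> n"
    and x: "x \<in> topspace (Euclidean_space n)"
    and \<alpha>: "0 < \<alpha>" "\<alpha> *\<^sub>R x \<in> K" and \<beta>: "0 < \<beta>" "\<beta> *\<^sub>R x \<in> L"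
  shows "pmean p \<alpha> \<beta> *\<^sub>R x \<in> lower_mean n p K L"
proof (cases "x = 0")
  case True
  then show ?thesis using zero_mem_lower_mean[OF K L n] by simp
next
  case False
  define l where "l = L2_set x {..<n}"
  define v where "v = (1 / l) *\<^sub>R x"
  have l: "0 < l" using L2_set_pos[OF x False] by (simp add: l_def)
  have v: "v \<in> unit_sphere n" unfolding v_def l_def by (rule normalize_mem_unit_sphere[OF x False])
  have gauge: "\<gamma> * l \<le> inverse (gauge_fun C v)"
    if C: "C \<in> convex_bodies0 n" and \<gamma>: "0 < \<gamma>" "\<gamma> *\<^sub>R x \<in> C" for C \<gamma>
  proof -
    have "v = (1 / (\<gamma> * l)) *\<^sub>R (\<gamma> *\<^sub>R x)" using \<gamma> l by (simp add: v_def)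
    then have "v \<in> (*\<^sub>R) (1 / (\<gamma> * l)) ` C" using \<gamma> by blast
    then have "gauge_fun C v \<le> 1 / (\<gamma> * l)" using \<gamma> l by (intro gauge_fun_le) auto
    moreover have "0 < gauge_fun C v"
      by (rule gauge_fun_attained(1)[OF C unit_sphereD[OF v]])
    ultimately show ?thesis using \<gamma> l by (simp add: field_simps)
  qed
  define m where "m = pmean p (inverse (gauge_fun K v)) (inverse (gauge_fun L v))"
  have "l * pmean p \<alpha> \<beta> = pmean p (\<alpha> * l) (\<beta> * l)"
    using pmean_scale[OF l \<alpha>(1) \<beta>(1), of p] by (simp add: mult.commute)
  also have "\<dots> \<le> m"
    unfolding m_def using gauge[OF K \<alpha>] gauge[OF L \<beta>] \<alpha> \<beta> l by (intro pmean_mono) auto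
  finally have le: "l * pmean p \<alpha> \<beta> \<le> m" .
  have pos: "0 < pmean p \<alpha> \<beta>" using \<alpha> \<beta> by (intro pmean_pos)
  then have m: "0 < m" using le l mult_pos_pos[of l "pmean p \<alpha> \<beta>"] by linarith
  define s where "s = l * pmean p \<alpha> \<beta> / m"
  have s: "0 \<le> s" "s \<le> 1" using le m l pos by (auto simp: s_def)
  have "(1 - s) *\<^sub>R 0 + s *\<^sub>R (m *\<^sub>R v) \<in> lower_mean n p K L"
  proof (rule convexD)
    show "convex (lower_mean n p K L)" by (simp add: lower_mean_def)
    show "m *\<^sub>R v \<in> lower_mean n p K L" unfolding m_def by (rule lower_mean_radial(3)[OF K L v])
  qed (use s zero_mem_lower_mean[OF K L n] in auto)
  also have "(1 - s) *\<^sub>R 0 + s *\<^sub>R (m *\<^sub>R v) = pmean p \<alpha> \<beta> *\<^sub>R x"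
    using l m by (simp add: s_def v_def)
  finally show ?thesis .
qed

lemma dotp_le_of_mem_upper_mean:
  assumes "K \<in> convex_bodies0 n" "L \<in> convex_bodies0 n" "a \<in> unit_sphere n" "y \<in> upper_mean n p K L"
    and "support_fun n K a \<le> \<alpha>" "support_fun n L a \<le> \<beta>"
  shows "dotp n a y \<le> pmean p \<alpha> \<beta>"
proof -
  have "dotp n a y \<le> pmean p (support_fun n K a) (support_fun n L a)"
    using assms by (simp add: upper_mean_def)
  also have "\<dots> \<le> pmean p \<alpha> \<beta>" using assms by (intro pmean_mono support_fun_pos)
  finally show ?thesis .
qed

lemma convex_upper_mean: "convex (upper_mean n p K L)"
proof (rule convexI)
  fix x y :: "nat \<Rightarrow> real" and u v :: real
  assume xy: "x \<in> upper_mean n p K L" "y \<in> upper_mean n p K L" and uv: "0 \<le> u" "0 \<le> v" "u + v = 1"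
  have "dotp n a (u *\<^sub>R x + v *\<^sub>R y) \<le> pmean p (support_fun n K a) (support_fun n L a)"
    if "a \<in> unit_sphere n" for a
  proof -
    have "dotp n a x \<le> pmean p (support_fun n K a) (support_fun n L a)"
      "dotp n a y \<le> pmean p (support_fun n K a) (support_fun n L a)"
      using xy that by (auto simp: upper_mean_def)
    then show ?thesis using uv by (simp add: dotp_add_right convex_bound_le)
  qed
  then show "u *\<^sub>R x + v *\<^sub>R y \<in> upper_mean n p K L"
    using xy by (simp add: upper_mean_def topspace_Euclidean_space)
qed

text \<open>
  The upper mean is convex, so generators suffice. For \<open>a\<cdot>v > 0\<close> the factor \<open>a\<cdot>v\<close> can be moved into the
  mean \<open>m\<^sub>p\<close>, whose arguments then are values of \<open>a\<close> at points of \<open>K\<close> and \<open>L\<close>; for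
  \<open>a\<cdot>v \<le> 0\<close> the value at the generator is not positive.
\<close>

lemma lower_mean_subset_upper_mean:
  assumes K: "K \<in> convex_bodies0 n" and L: "L \<in> convex_bodies0 n"
  shows "lower_mean n p K L \<subseteq> upper_mean n p K L"
  unfolding lower_mean_def
proof (rule hull_minimal)
  show "{pmean p (inverse (gauge_fun K v)) (inverse (gauge_fun L v)) *\<^sub>R v |v. v \<in> unit_sphere n}
    \<subseteq> upper_mean n p K L"
  proof clarify
    fix v assume v: "v \<in> unit_sphere n"
    note v0 = unit_sphereD[OF v]
    let ?\<alpha> = "inverse (gauge_fun K v)" and ?\<beta> = "inverse (gauge_fun L v)"
    note pos = lower_mean_radial(1,2)[OF K L v]
    have "dotp n a (pmean p ?\<alpha> ?\<beta> *\<^sub>R v) \<le> pmean p (support_fun n K a) (support_fun n L a)"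
      if a: "a \<in> unit_sphere n" for a
    proof (cases "0 < dotp n a v")
      case True
      have radial: "dotp n a v * inverse (gauge_fun C v) \<le> support_fun n C a"
        if C: "C \<in> convex_bodies0 n" for C
        using dotp_le_of_mem_scaleR[OF C _ gauge_fun_attained(2)[OF C v0], of a] gauge_fun_attained(1)[OF C v0]
        by (simp add: field_simps)
      have "dotp n a (pmean p ?\<alpha> ?\<beta> *\<^sub>R v) = pmean p (dotp n a v * ?\<alpha>) (dotp n a v * ?\<beta>)"
        using pmean_scale[OF True pos, of p] by simp
      also have "\<dots> \<le> pmean p (support_fun n K a) (support_fun n L a)"
        using True pos radial[OF K] radial[OF L] by (intro pmean_mono) auto
      finally show ?thesis .
    next
      case False
      then have "dotp n a (pmean p ?\<alpha> ?\<beta> *\<^sub>R v) \<le> 0"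
        using pmean_pos[OF pos, of p] by (simp add: mult_le_0_iff)
      also have "0 \<le> pmean p (support_fun n K a) (support_fun n L a)"
        using pmean_pos[OF support_fun_pos[OF K a] support_fun_pos[OF L a]] by (simp add: less_imp_le)
      finally show ?thesis .
    qed
    then show "pmean p ?\<alpha> ?\<beta> *\<^sub>R v \<in> upper_mean n p K L"
      using v0 by (simp add: upper_mean_def scaleR_mem_Euclidean_space)
  qed
qed (rule convex_upper_mean)

lemma Int_subset_lower_mean:
  assumes K: "K \<in> convex_bodies0 n" and L: "L \<in> convex_bodies0 n" and n: "1 \<le> n"
  shows "K \<inter> L \<subseteq> lower_mean n p K L"
  using pmean_scaleR_mem_lower_mean[OF K L n, of _ 1 1 p] convex_bodies0D(3)[OF K]
  by (auto simp: pmean_same)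

text \<open>
  The support function of \<open>K\<close> is at most \<open>R\<close> times that of \<open>L\<close>, and \<open>m\<^sub>p(R h, h) = m\<^sub>p(R, 1) h\<close>; the
  same holds with \<open>K\<close> and \<open>L\<close> exchanged.
\<close>

lemma upper_mean_subset_scaled_Int:
  assumes K: "K \<in> convex_bodies0 n" and L: "L \<in> convex_bodies0 n" and R: "0 < R"
    and KL: "K \<subseteq> (*\<^sub>R) R ` L" and LK: "L \<subseteq> (*\<^sub>R) R ` K"
  shows "upper_mean n p K L \<subseteq> (*\<^sub>R) (pmean p R 1) ` (K \<inter> L)"
proof
  fix x assume x: "x \<in> upper_mean n p K L"
  then have xE: "x \<in> topspace (Euclidean_space n)" by (simp add: upper_mean_def)
  have m: "0 < pmean p R 1" using R by (intro pmean_pos) auto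
  have "dotp n a x \<le> pmean p R 1 * support_fun n L a" if a: "a \<in> unit_sphere n" for a
    using dotp_le_of_mem_upper_mean[OF K L a x support_fun_mono_scaleR[OF K L _ KL, of a] order_refl]
      pmean_scale[OF support_fun_pos[OF L a] R, of 1 p] R by (simp add: mult.commute)
  then have "x \<in> (*\<^sub>R) (pmean p R 1) ` L" using mem_scaleR_iff_dotp_le[OF L m xE] by blast
  moreover have "dotp n a x \<le> pmean p R 1 * support_fun n K a" if a: "a \<in> unit_sphere n" for a
    using dotp_le_of_mem_upper_mean[OF K L a x order_refl support_fun_mono_scaleR[OF L K _ LK, of a]]
      pmean_scale[OF support_fun_pos[OF K a] _ R, of 1 p] R by (simp add: mult.commute pmean_commute)
  then have "x \<in> (*\<^sub>R) (pmean p R 1) ` K" using mem_scaleR_iff_dotp_le[OF K m xE] by blast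
  ultimately show "x \<in> (*\<^sub>R) (pmean p R 1) ` (K \<inter> L)" using m by (simp add: mem_scaleR_image_iff)
qed

text \<open>
  On the ray of \<open>x \<in> K\<close> the body \<open>L\<close> reaches at least \<open>x / R\<close>, so the lower mean reaches at least
  \<open>m\<^sub>p(1, 1/R) x\<close>, and the scaling factor is the inverse of this number.
\<close>

lemma convex_hull_Un_subset_scaled_lower_mean:
  assumes K: "K \<in> convex_bodies0 n" and L: "L \<in> convex_bodies0 n" and n: "1 \<le> n" and R: "0 < R"
    and KL: "K \<subseteq> (*\<^sub>R) R ` L" and LK: "L \<subseteq> (*\<^sub>R) R ` K"
  shows "convex hull (K \<union> L) \<subseteq> (*\<^sub>R) (R / pmean p R 1) ` lower_mean n p K L"
proof (rule hull_minimal)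
  have m: "0 < pmean p R 1" using R by (intro pmean_pos) auto
  have "K \<subseteq> (*\<^sub>R) (R / pmean p R 1) ` lower_mean n p K L"
    if K: "K \<in> convex_bodies0 n" and L: "L \<in> convex_bodies0 n" and KL: "K \<subseteq> (*\<^sub>R) R ` L" for K L
  proof
    fix x assume x: "x \<in> K"
    have "(1 / R) *\<^sub>R x \<in> L" using KL x mem_scaleR_image_iff[OF R] by blast
    then have "pmean p 1 (1 / R) *\<^sub>R x \<in> lower_mean n p K L"
      using x R convex_bodies0D(3)[OF K] by (intro pmean_scaleR_mem_lower_mean[OF K L n]) auto
    then show "x \<in> (*\<^sub>R) (R / pmean p R 1) ` lower_mean n p K L"
      using R m by (simp add: mem_scaleR_image_iff pmean_reciprocal)
  qed
  from this[OF K L KL] this[OF L K LK]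
  show "K \<union> L \<subseteq> (*\<^sub>R) (R / pmean p R 1) ` lower_mean n p K L"
    by (simp add: lower_mean_commute[of n p L K])
  show "convex ((*\<^sub>R) (R / pmean p R 1) ` lower_mean n p K L)"
    by (intro convex_scaling) (simp add: lower_mean_def)
qed

section \<open>The extreme mean and the convex hull of the union\<close>

lemma convex_combine_cone:
  assumes "convex C" "x \<in> C" "y \<in> C" "0 \<le> s" "0 \<le> t"
  obtains z where "z \<in> C" "s *\<^sub>R x + t *\<^sub>R y = (s + t) *\<^sub>R z"
proof (cases "s + t = 0")
  case True
  then show thesis using that[OF assms(2)] assms by (simp add: add_nonneg_eq_0_iff)
next
  case False
  have "(s / (s + t)) *\<^sub>R x + (t / (s + t)) *\<^sub>R y \<in> C"
    using assms False by (intro convexD) (auto simp: add_divide_distrib[symmetric])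
  then show thesis by (rule that) (use False in \<open>simp add: scaleR_add_right\<close>)
qed

text \<open>
  The set \<open>D\<close> is the convex hull of \<open>K \<union> L\<close>. The point is its compactness, which makes strict separation
  from it possible.
\<close>

lemma convex_hull_Un_compact:
  fixes K L :: "(nat \<Rightarrow> real) set"
  assumes "convex K" "convex L" "compact K" "compact L"
  defines "D \<equiv> (\<lambda>(s, x, y). (1 - s) *\<^sub>R x + s *\<^sub>R y) ` ({0..1} \<times> K \<times> L)"
  shows "convex D" "compact D"
proof -
  show "convex D"
  proof (rule convexI)
    fix d e :: "nat \<Rightarrow> real" and u v :: real
    assume "d \<in> D" "e \<in> D" and uv: "0 \<le> u" "0 \<le> v" "u + v = 1"
    then obtain s x y t x' y' where d: "d = (1 - s) *\<^sub>R x + s *\<^sub>R y" "0 \<le> s" "s \<le> 1" "x \<in> K" "y \<in> L"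
      and e: "e = (1 - t) *\<^sub>R x' + t *\<^sub>R y'" "0 \<le> t" "t \<le> 1" "x' \<in> K" "y' \<in> L"
      by (auto simp: D_def)
    obtain k where k: "k \<in> K" "(u * (1 - s)) *\<^sub>R x + (v * (1 - t)) *\<^sub>R x' = (u * (1 - s) + v * (1 - t)) *\<^sub>R k"
      using convex_combine_cone[OF assms(1) d(4) e(4), of "u * (1 - s)" "v * (1 - t)"] uv d e by auto
    obtain l where l: "l \<in> L" "(u * s) *\<^sub>R y + (v * t) *\<^sub>R y' = (u * s + v * t) *\<^sub>R l"
      using convex_combine_cone[OF assms(2) d(5) e(5), of "u * s" "v * t"] uv d e by auto
    define r where "r = u * s + v * t"
    have r: "1 - r = u * (1 - s) + v * (1 - t)" using uv by (simp add: r_def algebra_simps)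
    have "u * s \<le> u * 1" "v * t \<le> v * 1" using mult_left_mono[OF d(3) uv(1)] mult_left_mono[OF e(3) uv(2)] .
    then have r01: "0 \<le> r" "r \<le> 1" using uv d e by (auto simp: r_def)
    have "u *\<^sub>R d + v *\<^sub>R e = ((u * (1 - s)) *\<^sub>R x + (v * (1 - t)) *\<^sub>R x') + ((u * s) *\<^sub>R y + (v * t) *\<^sub>R y')"
      unfolding d e by (simp add: scaleR_add_right algebra_simps)
    also have "\<dots> = (1 - r) *\<^sub>R k + r *\<^sub>R l" by (simp only: k(2) l(2) r) (simp add: r_def)
    finally show "u *\<^sub>R d + v *\<^sub>R e \<in> D" using r01 k l by (force simp: D_def)
  qed
  have "continuous_on ({0..1} \<times> K \<times> L) (\<lambda>z. (1 - fst z) *\<^sub>R fst (snd z) + fst z *\<^sub>R snd (snd z))"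
  proof (rule continuous_on_coordinatewise_then_product)
    fix i
    have "continuous_on ({0..1} \<times> K \<times> L) (\<lambda>z. fst (snd z) i)" "continuous_on ({0..1} \<times> K \<times> L) (\<lambda>z. snd (snd z) i)"
      by (rule continuous_on_product_then_coordinatewise, intro continuous_on_fst continuous_on_snd continuous_on_id)+
    then show "continuous_on ({0..1} \<times> K \<times> L) (\<lambda>z. ((1 - fst z) *\<^sub>R fst (snd z) + fst z *\<^sub>R snd (snd z)) i)"
      unfolding plus_fun_apply scaleR_fun_apply
      by (intro continuous_on_add continuous_on_mult continuous_on_diff continuous_on_const continuous_on_fst continuous_on_id)
  qed
  then have "compact ((\<lambda>z. (1 - fst z) *\<^sub>R fst (snd z) + fst z *\<^sub>R snd (snd z)) ` ({0..1} \<times> K \<times> L))"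
    by (rule compact_continuous_image) (intro compact_Times assms compact_Icc)
  then show "compact D" by (simp add: D_def case_prod_unfold)
qed

text \<open>
  A direction separating \<open>x\<close> from the convex hull would have a value at \<open>x\<close> larger than both support
  functions, which contradicts \<open>x\<close> being in the upper mean for the maximum.
\<close>

lemma upper_mean_PInfty_subset_convex_hull:
  assumes K: "K \<in> convex_bodies0 n" and L: "L \<in> convex_bodies0 n"
  shows "upper_mean n \<infinity> K L \<subseteq> convex hull (K \<union> L)"
proof
  fix x assume x: "x \<in> upper_mean n \<infinity> K L"
  define D where "D = (\<lambda>(s, x, y). (1 - s) *\<^sub>R x + s *\<^sub>R y) ` ({0..1} \<times> K \<times> L)"
  note K' = convex_bodies0D[OF K] and L' = convex_bodies0D[OF L]
  have D: "convex D" "compact D" using convex_hull_Un_compact K' L' by (auto simp: D_def)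
  have KD: "K \<subseteq> D"
  proof
    fix y assume "y \<in> K"
    then show "y \<in> D" unfolding D_def using L'(4) by (intro image_eqI[of _ _ "(0, y, 0)"]) auto
  qed
  have LD: "L \<subseteq> D"
  proof
    fix y assume "y \<in> L"
    then show "y \<in> D" unfolding D_def using K'(4) by (intro image_eqI[of _ _ "(1, 0, y)"]) auto
  qed
  have DE: "D \<subseteq> topspace (Euclidean_space n)"
    using K'(3) L'(3) by (auto simp: D_def topspace_Euclidean_space subset_iff)
  have D_ne: "D \<noteq> {}" using KD K'(5) by blast
  have xE: "x \<in> topspace (Euclidean_space n)" using x by (simp add: upper_mean_def)
  have "x \<in> D"
  proof (rule ccontr)
    assume "x \<notin> D"
    then obtain a d where a: "a \<in> unit_sphere n" and d: "\<And>y. y \<in> D \<Longrightarrow> dotp n a y \<le> dotp n a d"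
        "dotp n a d < dotp n a x"
      using separating_functional[OF D(2,1) D_ne DE xE] by metis
    have "support_fun n K a \<le> dotp n a d" "support_fun n L a \<le> dotp n a d"
      using d(1) KD LD K'(5) L'(5) by (auto intro!: support_fun_le)
    then have "dotp n a x \<le> dotp n a d"
      using dotp_le_of_mem_upper_mean[OF K L a x] by fastforce
    then show False using d(2) by simp
  qed
  then obtain s y z where "x = (1 - s) *\<^sub>R y + s *\<^sub>R z" "0 \<le> s" "s \<le> 1" "y \<in> K" "z \<in> L"
    by (auto simp: D_def)
  moreover have "K \<subseteq> convex hull (K \<union> L)" "L \<subseteq> convex hull (K \<union> L)" by (auto intro: hull_inc)
  ultimately show "x \<in> convex hull (K \<union> L)"
    using convexD[OF convex_convex_hull, of y "K \<union> L" z "1 - s" s] by auto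
qed

lemma upper_mean_subset_upper_mean_PInfty:
  assumes K: "K \<in> convex_bodies0 n" and L: "L \<in> convex_bodies0 n"
  shows "upper_mean n p K L \<subseteq> upper_mean n \<infinity> K L"
  unfolding upper_mean_def
  using pmean_le_max[OF support_fun_pos[OF K] support_fun_pos[OF L], of _ _ p] by force

section \<open>The covering distance of two means\<close>

text \<open>
  The inequality \<open>step\<close> compares the two means along a point of \<open>K\<close> outside \<open>t L\<close> and a direction
  separating it. For \<open>t < R\<close> at least one of the inclusions \<open>K \<subseteq> t L\<close> and \<open>L \<subseteq> t K\<close> fails; as it
  may be the second one, \<open>step\<close> is stated for both orders of the two bodies.
\<close>

lemma cov_dist_means_ge:
  assumes K: "K \<in> convex_bodies0 n" and L: "L \<in> convex_bodies0 n" and n: "1 \<le> n"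
    and M: "lower_mean n p K L \<subseteq> M" "M \<subseteq> upper_mean n p K L"
    and M': "lower_mean n q K L \<subseteq> M'" "M' \<subseteq> upper_mean n q K L"
  defines "R \<equiv> cov_dist K L"
  shows "pmean q R 1 / pmean p R 1 \<le> cov_dist M M'"
proof -
  note KL = cov_dist_attained(1)[OF K L n, folded R_def] and LK = cov_dist_attained(2)[OF K L n, folded R_def]
  have R: "1 \<le> R" "0 < R" using cov_dist_attained(3)[OF K L n] by (auto simp: R_def)
  have m: "0 < pmean p R 1" "0 < pmean q R 1" using R by (auto intro: pmean_pos)
  have step: "t * pmean q R 1 \<le> lam * (R * pmean p R 1)"
    if K: "K \<in> convex_bodies0 n" and L: "L \<in> convex_bodies0 n"
      and KL: "K \<subseteq> (*\<^sub>R) R ` L" and t: "0 < t" "\<not> K \<subseteq> (*\<^sub>R) t ` L"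
      and M': "lower_mean n q K L \<subseteq> (*\<^sub>R) lam ` upper_mean n p K L" and lam: "0 \<le> lam"
    for K L t lam
  proof -
    obtain x where x: "x \<in> K" "x \<notin> (*\<^sub>R) t ` L" using t by blast
    then have xE: "x \<in> topspace (Euclidean_space n)" using convex_bodies0D(3)[OF K] by blast
    then obtain a where a: "a \<in> unit_sphere n" "t * support_fun n L a < dotp n a x"
      using mem_scaleR_iff_dotp_le[OF L t(1) xE] x by (auto simp: not_le)
    let ?h = "support_fun n L a"
    have h: "0 < ?h" by (rule support_fun_pos[OF L a(1)])
    have "(1 / R) *\<^sub>R x \<in> L" using KL x mem_scaleR_image_iff[OF R(2)] by blast
    then have "pmean q 1 (1 / R) *\<^sub>R x \<in> lower_mean n q K L"
      using x R xE by (intro pmean_scaleR_mem_lower_mean[OF K L n]) auto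
    then obtain y where y: "y \<in> upper_mean n p K L" "pmean q 1 (1 / R) *\<^sub>R x = lam *\<^sub>R y"
      using M' by blast
    have "dotp n a y \<le> pmean p (R * ?h) ?h"
      using R by (intro dotp_le_of_mem_upper_mean[OF K L a(1) y(1)] support_fun_mono_scaleR[OF K L _ KL]) auto
    also have "\<dots> = ?h * pmean p R 1" using pmean_scale[OF h R(2), of 1 p] by (simp add: mult.commute)
    finally have "lam * dotp n a y \<le> lam * (?h * pmean p R 1)" using lam by (rule mult_left_mono)
    moreover have "lam * dotp n a y = pmean q R 1 / R * dotp n a x"
      using arg_cong[OF y(2), of "dotp n a"] R by (simp add: pmean_reciprocal)
    moreover have "pmean q R 1 / R * (t * ?h) \<le> pmean q R 1 / R * dotp n a x"
      using a m R by (intro mult_left_mono) auto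
    ultimately have "pmean q R 1 / R * (t * ?h) \<le> lam * (?h * pmean p R 1)" by linarith
    then have "t * pmean q R 1 * ?h \<le> lam * (R * pmean p R 1) * ?h" using R by (simp add: field_simps)
    then show ?thesis using h by simp
  qed
  have "pmean q R 1 / pmean p R 1 \<le> cov_radius M' M"
  proof (rule cov_radius_ge)
    have "M' \<subseteq> (*\<^sub>R) (pmean q R 1) ` (K \<inter> L)"
      using M'(2) upper_mean_subset_scaled_Int[OF K L R(2) KL LK, of q] by blast
    then show "M' \<subseteq> (*\<^sub>R) (pmean q R 1) ` M"
      using Int_subset_lower_mean[OF K L n, of p] M(1) by blast
  next
    fix lam :: real assume lam: "0 \<le> lam" "M' \<subseteq> (*\<^sub>R) lam ` M"
    then have incl: "lower_mean n q K L \<subseteq> (*\<^sub>R) lam ` upper_mean n p K L" using M M' by blast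
    \<comment> \<open>take \<open>t = z R\<close> and let \<open>z\<close> tend to \<open>1\<close>\<close>
    have "pmean q R 1 \<le> lam * pmean p R 1"
    proof (rule field_le_mult_one_interval)
      fix z :: real assume z: "0 < z" "z < 1"
      have "\<not> (K \<subseteq> (*\<^sub>R) (z * R) ` L \<and> L \<subseteq> (*\<^sub>R) (z * R) ` K)"
      proof
        assume "K \<subseteq> (*\<^sub>R) (z * R) ` L \<and> L \<subseteq> (*\<^sub>R) (z * R) ` K"
        then have "R \<le> z * R"
          using z R cov_radius_le[of "z * R" K L] cov_radius_le[of "z * R" L K] 
          by (auto simp: cov_dist_def R_def)
        then show False using z R by simp
      qed
      then have "z * R * pmean q R 1 \<le> lam * (R * pmean p R 1)"
        using step[OF K L KL _ _ incl lam(1), of "z * R"] step[OF L K LK _ _ _ lam(1), of "z * R"] incl z R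
        by (auto simp: lower_mean_commute[of n q L K] upper_mean_commute[of n p L K])
      then have "R * (z * pmean q R 1) \<le> R * (lam * pmean p R 1)" by (simp add: mult_ac)
      then show "z * pmean q R 1 \<le> lam * pmean p R 1" using R by simp
    qed
    then show "pmean q R 1 / pmean p R 1 \<le> lam" using m by (simp add: field_simps)
  qed (use m in simp)
  then show ?thesis by (simp add: cov_dist_def)
qed

text \<open>
  In both cases \<open>M \<subseteq> M'\<close>, since one of the two sets is \<open>K \<inter> L\<close> or the convex hull of \<open>K \<union> L\<close>, and the
  factor needed to cover \<open>M'\<close> by \<open>M\<close> is at most the lower bound that holds for all exponents.
\<close>

lemma cov_dist_means_eq:
  assumes K: "K \<in> convex_bodies0 n" and L: "L \<in> convex_bodies0 n" and n: "1 \<le> n"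
    and M: "lower_mean n p K L \<subseteq> M" "M \<subseteq> upper_mean n p K L"
    and M': "lower_mean n q K L \<subseteq> M'" "M' \<subseteq> upper_mean n q K L"
    and pq: "p = -\<infinity> \<or> q = \<infinity>"
  defines "R \<equiv> cov_dist K L"
  shows "cov_dist M M' = pmean q R 1 / pmean p R 1"
proof (rule antisym)
  note KL = cov_dist_attained(1)[OF K L n, folded R_def] and LK = cov_dist_attained(2)[OF K L n, folded R_def]
  have R: "1 \<le> R" "0 < R" using cov_dist_attained(3)[OF K L n] by (auto simp: R_def)
  have m: "0 < pmean p R 1" "0 < pmean q R 1" using R by (auto intro: pmean_pos)
  note Int = Int_subset_lower_mean[OF K L n]
  note hull = convex_hull_Un_subset_scaled_lower_mean[OF K L n R(2) KL LK]
  have "M \<subseteq> (*\<^sub>R) 1 ` M' \<and> M' \<subseteq> (*\<^sub>R) (pmean q R 1 / pmean p R 1) ` M"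
    using pq
  proof
    assume p: "p = -\<infinity>"
    have "upper_mean n p K L \<subseteq> K \<inter> L"
      using upper_mean_subset_scaled_Int[OF K L R(2) KL LK, of p] p R by simp
    with M(2) have "M \<subseteq> K \<inter> L" by blast
    moreover have "M' \<subseteq> (*\<^sub>R) (pmean q R 1) ` (K \<inter> L)"
      using M'(2) upper_mean_subset_scaled_Int[OF K L R(2) KL LK, of q] by blast
    moreover have "K \<inter> L \<subseteq> M" "K \<inter> L \<subseteq> M'" using Int[of p] Int[of q] M(1) M'(1) by auto
    moreover have "pmean q R 1 / pmean p R 1 = pmean q R 1" using p R by simp
    moreover have "(*\<^sub>R) 1 ` M' = M'" by simp
    ultimately show ?thesis by (metis image_mono subset_trans)
  next
    assume q: "q = \<infinity>"
    have M'q: "M' \<subseteq> convex hull (K \<union> L)"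
      using M'(2) upper_mean_PInfty_subset_convex_hull[OF K L] q by simp
    have "M \<subseteq> convex hull (K \<union> L)"
      using M(2) upper_mean_subset_upper_mean_PInfty[OF K L, of p] upper_mean_PInfty_subset_convex_hull[OF K L] by blast
    also have "\<dots> \<subseteq> (*\<^sub>R) 1 ` M'" using hull[of q] q M'(1) R by simp
    finally show ?thesis using M'q hull[of p] M(1) q R by (auto simp: max_def) blast
  qed
  moreover have "1 \<le> pmean q R 1 / pmean p R 1"
    using pq min_le_pmean[of R 1 q] pmean_le_max[of R 1 p] R m by auto
  ultimately have "cov_radius M M' \<le> pmean q R 1 / pmean p R 1" "cov_radius M' M \<le> pmean q R 1 / pmean p R 1"
    using cov_radius_le[of 1 M M'] cov_radius_le[of "pmean q R 1 / pmean p R 1" M' M] by linarith+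
  then show "cov_dist M M' \<le> pmean q R 1 / pmean p R 1" by (simp add: cov_dist_def)
  show "pmean q R 1 / pmean p R 1 \<le> cov_dist M M'"
    unfolding R_def by (rule cov_dist_means_ge[OF K L n M M'])
qed

section \<open>Homothetic pairs of bodies\<close>

text \<open>
  The intersection of \<open>\<real>\<^sup>n\<close> with a product of intervals, so that its compactness and its interior can be
  read off from the product topology.
\<close>

definition coord_box :: "nat \<Rightarrow> real \<Rightarrow> (nat \<Rightarrow> real) set"
  where "coord_box n c = {x \<in> topspace (Euclidean_space n). \<forall>i<n. \<bar>x i\<bar> \<le> c}"

lemma coord_box_mem_convex_bodies0:
  assumes c: "0 < c"
  shows "coord_box n c \<in> convex_bodies0 n"
proof -
  have interval: "\<bar>t\<bar> \<le> c \<longleftrightarrow> - c \<le> t \<and> t \<le> c" for t :: real by auto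
  have "convex (coord_box n c)"
  proof (rule convexI)
    fix x y :: "nat \<Rightarrow> real" and u v :: real
    assume xy: "x \<in> coord_box n c" "y \<in> coord_box n c" and uv: "0 \<le> u" "0 \<le> v" "u + v = 1"
    have "\<bar>u * x i + v * y i\<bar> \<le> c" if "i < n" for i
    proof -
      have "\<bar>u * x i + v * y i\<bar> \<le> u * \<bar>x i\<bar> + v * \<bar>y i\<bar>"
        using uv abs_triangle_ineq[of "u * x i" "v * y i"] by (simp add: abs_mult)
      also have "\<dots> \<le> c" using xy uv that by (intro convex_bound_le) (auto simp: coord_box_def)
      finally show ?thesis .
    qed
    then show "u *\<^sub>R x + v *\<^sub>R y \<in> coord_box n c" using xy by (auto simp: coord_box_def topspace_Euclidean_space)
  qed
  moreover have "compactin (Euclidean_space n) (coord_box n c)"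
  proof -
    have "compactin (powertop_real UNIV) (Pi\<^sub>E UNIV (\<lambda>i. if i < n then {- c..c} else {0}))"
      by (subst compactin_PiE) auto
    moreover have "Pi\<^sub>E UNIV (\<lambda>i. if i < n then {- c..c} else {0}) = coord_box n c"
      by (auto simp: coord_box_def PiE_iff topspace_Euclidean_space interval split: if_splits)
    ultimately show ?thesis
      by (auto simp: compactin_Euclidean_space_iff euclidean_product_topology coord_box_def)
  qed
  moreover have "0 \<in> (Euclidean_space n) interior_of (coord_box n c)"
  proof -
    define U where "U = Pi\<^sub>E UNIV (\<lambda>i. if i < n then {- c<..<c} else UNIV)"
    have "open U" unfolding U_def
      by (rule open_PiE) (auto intro: finite_subset[of _ "{..<n}"] split: if_splits)
    then have "openin (Euclidean_space n) (U \<inter> topspace (Euclidean_space n))"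
      by (auto simp: Euclidean_space_def euclidean_product_topology openin_subtopology)
    moreover have "0 \<in> U \<inter> topspace (Euclidean_space n)"
      using c by (auto simp: U_def topspace_Euclidean_space)
    moreover have "U \<inter> topspace (Euclidean_space n) \<subseteq> coord_box n c"
      by (auto simp: U_def coord_box_def PiE_iff interval less_imp_le split: if_splits)
    ultimately show ?thesis by (auto simp: interior_of_def)
  qed
  ultimately show ?thesis by (simp add: convex_bodies0_def)
qed

lemma coord_box_scaleR:
  assumes "0 < c"
  shows "coord_box n c = (*\<^sub>R) c ` coord_box n 1"
proof (rule set_eqI)
  fix x
  show "x \<in> coord_box n c \<longleftrightarrow> x \<in> (*\<^sub>R) c ` coord_box n 1"
    using assms unfolding mem_scaleR_image_iff[OF assms]
    by (auto simp: coord_box_def topspace_Euclidean_space abs_mult field_simps)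
qed

lemma cov_radius_scaleR:
  assumes L: "L \<in> convex_bodies0 n" and n: "1 \<le> n" and st: "0 < s" "0 < t"
  shows "cov_radius ((*\<^sub>R) s ` L) ((*\<^sub>R) t ` L) = s / t"
proof (rule antisym)
  have eq: "(*\<^sub>R) s ` L = (*\<^sub>R) (s / t) ` ((*\<^sub>R) t ` L)" using st by (simp add: image_image)
  show "cov_radius ((*\<^sub>R) s ` L) ((*\<^sub>R) t ` L) \<le> s / t"
    using st by (intro cov_radius_le) (auto simp: eq)
  show "s / t \<le> cov_radius ((*\<^sub>R) s ` L) ((*\<^sub>R) t ` L)"
  proof (rule cov_radius_ge[of "s / t"])
    fix r :: real assume r: "0 \<le> r" "(*\<^sub>R) s ` L \<subseteq> (*\<^sub>R) r ` ((*\<^sub>R) t ` L)"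
    obtain a where a: "a \<in> unit_sphere n" using unit_sphere_nonempty[OF n] by blast
    have "support_fun n L a \<le> r * t / s * support_fun n L a"
    proof (rule support_fun_le)
      fix x assume "x \<in> L"
      then have "s *\<^sub>R x \<in> (*\<^sub>R) r ` ((*\<^sub>R) t ` L)" using r by blast
      then have "s *\<^sub>R x \<in> (*\<^sub>R) (r * t) ` L" by (auto simp: image_image)
      then show "dotp n a x \<le> r * t / s * support_fun n L a"
        using dotp_le_of_mem_scaleR[OF L, of "r * t" "s *\<^sub>R x" a] r st by (simp add: field_simps)
    qed (rule convex_bodies0D(5)[OF L])
    then have "1 * support_fun n L a \<le> r * t / s * support_fun n L a" by simp
    then have "1 \<le> r * t / s" using support_fun_pos[OF L a] by (simp only: mult_le_cancel_right)
    then show "s / t \<le> r" using st by (simp add: field_simps)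
  qed (use st eq in auto)
qed

text \<open>
  Points \<open>c x\<close> of \<open>K\<close> and \<open>x\<close> of \<open>L\<close> on the same ray give \<open>m\<^sub>p(c, 1) L\<close> as a subset of the lower mean, and
  the equation \<open>h\<^sub>K = c h\<^sub>L\<close> of support functions gives it as a superset of the upper mean.
\<close>

lemma mean_of_scaled:
  assumes K: "K \<in> convex_bodies0 n" and L: "L \<in> convex_bodies0 n" and n: "1 \<le> n"
    and c: "0 < c" and KL: "K = (*\<^sub>R) c ` L"
    and M: "lower_mean n p K L \<subseteq> M" "M \<subseteq> upper_mean n p K L"
  shows "M = (*\<^sub>R) (pmean p c 1) ` L"
proof
  have m: "0 < pmean p c 1" using c by (intro pmean_pos) auto
  show "(*\<^sub>R) (pmean p c 1) ` L \<subseteq> M"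
  proof clarify
    fix x assume "x \<in> L"
    then show "pmean p c 1 *\<^sub>R x \<in> M"
      using M(1) c convex_bodies0D(3)[OF L] pmean_scaleR_mem_lower_mean[OF K L n, of x c 1 p] by (auto simp: KL)
  qed
  show "M \<subseteq> (*\<^sub>R) (pmean p c 1) ` L"
  proof
    fix x assume "x \<in> M"
    then have x: "x \<in> upper_mean n p K L" using M by blast
    have "dotp n a x \<le> pmean p c 1 * support_fun n L a" if a: "a \<in> unit_sphere n" for a
      using dotp_le_of_mem_upper_mean[OF K L a x support_fun_mono_scaleR[OF K L, of c a] order_refl]
        pmean_scale[OF support_fun_pos[OF L a] c, of 1 p] c KL by (simp add: mult.commute)
    then show "x \<in> (*\<^sub>R) (pmean p c 1) ` L"
      using mem_scaleR_iff_dotp_le[OF L m] x by (simp add: upper_mean_def)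
  qed
qed

lemma cov_dist_scaleR:
  assumes L: "L \<in> convex_bodies0 n" and n: "1 \<le> n" and st: "0 < s" "s \<le> t"
  shows "cov_dist ((*\<^sub>R) s ` L) ((*\<^sub>R) t ` L) = t / s"
proof -
  have "s / t \<le> 1" "1 \<le> t / s" using st by auto
  then have "s / t \<le> t / s" by linarith
  then show ?thesis
    using cov_radius_scaleR[OF L n, of s t] cov_radius_scaleR[OF L n, of t s] st by (simp add: cov_dist_def max.absorb2)
qed

section \<open>Stability of the inequality between the means\<close>

lemma mean_sandwich:
  assumes "K \<in> convex_bodies0 n" "L \<in> convex_bodies0 n" "Mp \<in> {upper_mean n p, lower_mean n p}"
  shows "lower_mean n p K L \<subseteq> Mp K L" "Mp K L \<subseteq> upper_mean n p K L"
  using assms(3) lower_mean_subset_upper_mean[OF assms(1,2)] by auto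

text \<open>
  The hypothesis on \<open>\<epsilon>\<close> enters only through \<open>f R \<le> f c\<close>, where strict monotonicity of \<open>f\<close> gives \<open>R \<le> c\<close>;
  this is the range in which the parabola is a lower bound for \<open>f\<close>.
\<close>

lemma cov_dist_le_of_means_close:
  fixes p q \<delta> :: real
  assumes pq: "p < q" and K: "K \<in> convex_bodies0 n" and L: "L \<in> convex_bodies0 n" and n: "1 \<le> n"
    and M: "lower_mean n p K L \<subseteq> M" "M \<subseteq> upper_mean n p K L"
    and M': "lower_mean n q K L \<subseteq> M'" "M' \<subseteq> upper_mean n q K L"
    and \<delta>: "0 \<le> \<delta>" "\<delta> < 1"
  defines "\<epsilon> \<equiv> cov_dist M M' - 1" and "c \<equiv> 1 + \<delta> / (max \<bar>p\<bar> \<bar>q\<bar> + 3 / 2)"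
  assumes close: "\<epsilon> \<le> pmean q c 1 / pmean p c 1 - 1"
  shows "cov_dist K L \<le> 1 + sqrt (8 * \<epsilon> / ((1 - \<delta>) * (q - p)))"
proof -
  define P where "P = max \<bar>p\<bar> \<bar>q\<bar>"
  define R where "R = cov_dist K L"
  have P: "0 < P + 3 / 2" "\<bar>p\<bar> \<le> P" "\<bar>q\<bar> \<le> P" by (auto simp: P_def)
  have R: "1 \<le> R" unfolding R_def by (rule cov_dist_attained(3)[OF K L n])
  have c: "1 \<le> c" "(P + 3 / 2) * (c - 1) = \<delta>" using \<delta> P by (auto simp: c_def P_def)
  have ge: "pmean q R 1 / pmean p R 1 \<le> 1 + \<epsilon>"
    using cov_dist_means_ge[OF K L n M M'] by (simp add: \<epsilon>_def R_def)
  have "R \<le> c"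
  proof (rule ccontr)
    assume "\<not> R \<le> c"
    then have "pmean q c 1 / pmean p c 1 < pmean q R 1 / pmean p R 1"
      using pmean_ratio_strict_mono[OF pq c(1)] by simp
    then show False using ge close by simp
  qed
  then have "(P + 3 / 2) * (R - 1) \<le> \<delta>"
    using mult_left_mono[of "R - 1" "c - 1" "P + 3 / 2"] P c by simp
  then have "1 + (1 - \<delta>) * (q - p) * (R - 1)\<^sup>2 / 8 \<le> pmean q (1 + (R - 1)) 1 / pmean p (1 + (R - 1)) 1"
    using pq P R \<delta> by (intro pmean_ratio_ge[of p q P]) auto
  then have "(1 - \<delta>) * (q - p) * (R - 1)\<^sup>2 \<le> 8 * \<epsilon>" using ge by simp
  moreover have "0 < (1 - \<delta>) * (q - p)" using \<delta> pq by simp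
  ultimately have "(R - 1)\<^sup>2 \<le> 8 * \<epsilon> / ((1 - \<delta>) * (q - p))" by (simp add: field_simps)
  then have "R - 1 \<le> sqrt (8 * \<epsilon> / ((1 - \<delta>) * (q - p)))" by (rule real_le_rsqrt)
  then show ?thesis by (simp add: R_def)
qed

lemma exists_sharp_pair:
  fixes p q c :: real
  assumes pq: "p < q" and n: "1 \<le> n" and c: "1 \<le> c"
  shows "\<exists>K\<in>convex_bodies0 n. \<exists>L\<in>convex_bodies0 n. cov_dist K L = c \<and>
    (\<forall>M M'. lower_mean n p K L \<subseteq> M \<and> M \<subseteq> upper_mean n p K L \<and> lower_mean n q K L \<subseteq> M' \<and> M' \<subseteq> upper_mean n q K L
      \<longrightarrow> cov_dist M M' = pmean q c 1 / pmean p c 1)"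
proof -
  have K: "coord_box n c \<in> convex_bodies0 n" and L: "coord_box n 1 \<in> convex_bodies0 n"
    using c by (auto intro: coord_box_mem_convex_bodies0)
  have KL: "coord_box n c = (*\<^sub>R) c ` coord_box n 1" using c by (intro coord_box_scaleR) auto
  have dist: "cov_dist (coord_box n c) (coord_box n 1) = c"
    using cov_dist_scaleR[OF L n, of 1 c] c by (simp add: cov_dist_commute KL)
  have means: "cov_dist M M' = pmean q c 1 / pmean p c 1"
    if "lower_mean n p (coord_box n c) (coord_box n 1) \<subseteq> M" "M \<subseteq> upper_mean n p (coord_box n c) (coord_box n 1)"
      "lower_mean n q (coord_box n c) (coord_box n 1) \<subseteq> M'" "M' \<subseteq> upper_mean n q (coord_box n c) (coord_box n 1)" for M M'
  proof -
    have "M = (*\<^sub>R) (pmean p c 1) ` coord_box n 1" "M' = (*\<^sub>R) (pmean q c 1) ` coord_box n 1"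
      using c mean_of_scaled[OF K L n _ KL that(1,2)] mean_of_scaled[OF K L n _ KL that(3,4)] by auto
    moreover have m: "0 < pmean p c 1" using c by (intro pmean_pos) auto
    moreover have "pmean p c 1 \<le> pmean q c 1"
    proof -
      have "1 \<le> pmean q c 1 / pmean p c 1"
        using pmean_ratio_strict_mono[OF pq, of 1 c] c by (cases "c = 1") (auto simp: pmean_same)
      then show ?thesis using m by (simp add: field_simps)
    qed
    ultimately show ?thesis using cov_dist_scaleR[OF L n] by simp
  qed
  show ?thesis using K L dist means by blast
qed

text \<open>
  If one exponent is infinite, the ratio is a single mean with a finite exponent: \<open>m\<^sub>q\<close> for \<open>p = -\<infinity>\<close>, and
  \<open>m\<^sub>-\<^sub>p\<close> for \<open>q = \<infinity>\<close>.
\<close>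

lemma cov_dist_expansion:
  assumes pq: "p < q" and inf: "(p = -\<infinity> \<and> q \<noteq> \<infinity>) \<or> (p \<noteq> -\<infinity> \<and> q = \<infinity>)"
  shows "\<exists>C>0. \<exists>\<epsilon>\<^sub>0>0. \<forall>R\<ge>1. pmean q R 1 / pmean p R 1 - 1 \<le> \<epsilon>\<^sub>0 \<longrightarrow>
     \<bar>R - 1 - 2 * (pmean q R 1 / pmean p R 1 - 1)\<bar> \<le> C * (pmean q R 1 / pmean p R 1 - 1)\<^sup>2"
proof -
  obtain s where s: "\<And>R. 1 \<le> R \<Longrightarrow> pmean q R 1 / pmean p R 1 = pmean (ereal s) R 1"
  proof (cases "p = -\<infinity>")
    case True
    then obtain s where "q = ereal s" using inf pq by (cases q) auto
    then show thesis using that[of s] True by simp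
  next
    case False
    then obtain r where "p = ereal r" using inf pq by (cases p) auto
    then show thesis using that[of "- r"] False inf by (simp add: max_div_pmean)
  qed
  then show ?thesis using pmean_expansion_at_one[of s] by simp
qed

theorem theorem1p4:
  fixes p q :: ereal
  assumes "p < q"
  shows
    "(p \<noteq> -\<infinity> \<and> q \<noteq> \<infinity> \<longrightarrow>
       (\<forall>n\<ge>1. \<forall>Mp\<in>{upper_mean n p, lower_mean n p}. \<forall>Mq\<in>{upper_mean n q, lower_mean n q}.
         (\<forall>K\<in>convex_bodies0 n. \<forall>L\<in>convex_bodies0 n. \<forall>\<delta>::real. 0 \<le> \<delta> \<and> \<delta> < 1 \<longrightarrow>
            (let \<epsilon> = cov_dist (Mp K L) (Mq K L) - 1;
                 c = 1 + \<delta> / (max \<bar>real_of_ereal p\<bar> \<bar>real_of_ereal q\<bar> + 3 / 2)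
             in \<epsilon> \<le> pmean q c 1 / pmean p c 1 - 1 \<longrightarrow>
                cov_dist K L
                  \<le> 1 + sqrt (8 * \<epsilon> / ((1 - \<delta>) * (real_of_ereal q - real_of_ereal p))))) \<and>
         (\<forall>c'::real. c' \<ge> 1 \<longrightarrow>
            (let \<epsilon>' = pmean q c' 1 / pmean p c' 1 - 1
             in \<exists>K'\<in>convex_bodies0 n. \<exists>L'\<in>convex_bodies0 n.
                  \<epsilon>' = cov_dist (Mp K' L') (Mq K' L') - 1 \<and>
                  1 + sqrt (8 * \<epsilon>' / (real_of_ereal q - real_of_ereal p)) \<le> cov_dist K' L'))))
     \<and>
     ((p = -\<infinity> \<and> q \<noteq> \<infinity>) \<or> (p \<noteq> -\<infinity> \<and> q = \<infinity>) \<longrightarrow>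
       (\<exists>C>0. \<exists>\<epsilon>\<^sub>0>0.
         \<forall>n\<ge>1. \<forall>Mp\<in>{upper_mean n p, lower_mean n p}. \<forall>Mq\<in>{upper_mean n q, lower_mean n q}.
           \<forall>K\<in>convex_bodies0 n. \<forall>L\<in>convex_bodies0 n.
             (let \<epsilon> = cov_dist (Mp K L) (Mq K L) - 1
              in \<epsilon> \<le> \<epsilon>\<^sub>0 \<longrightarrow> \<bar>cov_dist K L - 1 - 2 * \<epsilon>\<bar> \<le> C * \<epsilon>\<^sup>2)))
     \<and>
     (p = -\<infinity> \<and> q = \<infinity> \<longrightarrow>
       (\<forall>n\<ge>1. \<forall>Mp\<in>{upper_mean n p, lower_mean n p}. \<forall>Mq\<in>{upper_mean n q, lower_mean n q}.
         \<forall>K\<in>convex_bodies0 n. \<forall>L\<in>convex_bodies0 n.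
           (let \<epsilon> = cov_dist (Mp K L) (Mq K L) - 1
            in cov_dist K L = 1 + \<epsilon>)))"
  unfolding Let_def
proof (intro conjI impI)
  assume fin: "p \<noteq> -\<infinity> \<and> q \<noteq> \<infinity>"
  obtain p' q' where p': "p = ereal p'" and q': "q = ereal q'" using fin assms by (cases p; cases q) auto
  have pq: "p' < q'" using assms by (simp add: p' q')
  show "\<forall>n\<ge>1. \<forall>Mp\<in>{upper_mean n p, lower_mean n p}. \<forall>Mq\<in>{upper_mean n q, lower_mean n q}.
      (\<forall>K\<in>convex_bodies0 n. \<forall>L\<in>convex_bodies0 n. \<forall>\<delta>::real. 0 \<le> \<delta> \<and> \<delta> < 1 \<longrightarrow>
        cov_dist (Mp K L) (Mq K L) - 1
          \<le> pmean q (1 + \<delta> / (max \<bar>real_of_ereal p\<bar> \<bar>real_of_ereal q\<bar> + 3 / 2)) 1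
            / pmean p (1 + \<delta> / (max \<bar>real_of_ereal p\<bar> \<bar>real_of_ereal q\<bar> + 3 / 2)) 1 - 1 \<longrightarrow>
        cov_dist K L \<le> 1 + sqrt (8 * (cov_dist (Mp K L) (Mq K L) - 1)
          / ((1 - \<delta>) * (real_of_ereal q - real_of_ereal p)))) \<and>
      (\<forall>c'\<ge>1. \<exists>K'\<in>convex_bodies0 n. \<exists>L'\<in>convex_bodies0 n.
        pmean q c' 1 / pmean p c' 1 - 1 = cov_dist (Mp K' L') (Mq K' L') - 1 \<and>
        1 + sqrt (8 * (pmean q c' 1 / pmean p c' 1 - 1) / (real_of_ereal q - real_of_ereal p))
          \<le> cov_dist K' L')"
  proof (intro allI impI ballI conjI)
    fix n :: nat and Mp Mq K L and \<delta> :: real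
    assume n: "1 \<le> n" and Mp: "Mp \<in> {upper_mean n p, lower_mean n p}"
      and Mq: "Mq \<in> {upper_mean n q, lower_mean n q}"
      and K: "K \<in> convex_bodies0 n" and L: "L \<in> convex_bodies0 n" and \<delta>: "0 \<le> \<delta> \<and> \<delta> < 1"
      and close: "cov_dist (Mp K L) (Mq K L) - 1
          \<le> pmean q (1 + \<delta> / (max \<bar>real_of_ereal p\<bar> \<bar>real_of_ereal q\<bar> + 3 / 2)) 1
            / pmean p (1 + \<delta> / (max \<bar>real_of_ereal p\<bar> \<bar>real_of_ereal q\<bar> + 3 / 2)) 1 - 1"
    show "cov_dist K L \<le> 1 + sqrt (8 * (cov_dist (Mp K L) (Mq K L) - 1)
          / ((1 - \<delta>) * (real_of_ereal q - real_of_ereal p)))"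
      using cov_dist_le_of_means_close[OF pq K L n mean_sandwich[OF K L Mp, unfolded p']
          mean_sandwich[OF K L Mq, unfolded q'], of \<delta>] \<delta> close by (simp add: p' q')
  next
    fix n :: nat and Mp Mq and c' :: real
    assume n: "1 \<le> n" and Mp: "Mp \<in> {upper_mean n p, lower_mean n p}"
      and Mq: "Mq \<in> {upper_mean n q, lower_mean n q}" and c': "1 \<le> c'"
    obtain K L where K: "K \<in> convex_bodies0 n" and L: "L \<in> convex_bodies0 n" and d: "cov_dist K L = c'"
      and M: "\<And>M M'. lower_mean n p' K L \<subseteq> M \<and> M \<subseteq> upper_mean n p' K L \<and> lower_mean n q' K L \<subseteq> M'
        \<and> M' \<subseteq> upper_mean n q' K L \<Longrightarrow> cov_dist M M' = pmean q' c' 1 / pmean p' c' 1"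
      using exists_sharp_pair[OF pq n c'] by blast
    have eq: "pmean q c' 1 / pmean p c' 1 - 1 = cov_dist (Mp K L) (Mq K L) - 1"
      using M[of "Mp K L" "Mq K L"] mean_sandwich[OF K L Mp] mean_sandwich[OF K L Mq] by (simp add: p' q')
    have "8 * (pmean q c' 1 / pmean p c' 1 - 1) / (q' - p') \<le> (c' - 1)\<^sup>2"
      using pmean_ratio_le[OF pq c'] pq by (simp add: p' q' field_simps)
    then have "sqrt (8 * (pmean q c' 1 / pmean p c' 1 - 1) / (q' - p')) \<le> c' - 1"
      using c' by (intro real_le_lsqrt) auto
    then have "1 + sqrt (8 * (pmean q c' 1 / pmean p c' 1 - 1) / (real_of_ereal q - real_of_ereal p))
        \<le> cov_dist K L"
      using d by (simp add: p' q')
    with eq K L show "\<exists>K'\<in>convex_bodies0 n. \<exists>L'\<in>convex_bodies0 n.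
        pmean q c' 1 / pmean p c' 1 - 1 = cov_dist (Mp K' L') (Mq K' L') - 1 \<and>
        1 + sqrt (8 * (pmean q c' 1 / pmean p c' 1 - 1) / (real_of_ereal q - real_of_ereal p))
          \<le> cov_dist K' L'"
      by blast
  qed
next
  assume inf: "(p = -\<infinity> \<and> q \<noteq> \<infinity>) \<or> (p \<noteq> -\<infinity> \<and> q = \<infinity>)"
  obtain C \<epsilon>\<^sub>0 where C: "0 < C" "0 < \<epsilon>\<^sub>0" and expansion:
    "\<And>R. 1 \<le> R \<Longrightarrow> pmean q R 1 / pmean p R 1 - 1 \<le> \<epsilon>\<^sub>0 \<Longrightarrow>
     \<bar>R - 1 - 2 * (pmean q R 1 / pmean p R 1 - 1)\<bar> \<le> C * (pmean q R 1 / pmean p R 1 - 1)\<^sup>2"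
    using cov_dist_expansion[OF assms inf] by blast
  show "\<exists>C>0. \<exists>\<epsilon>\<^sub>0>0. \<forall>n\<ge>1. \<forall>Mp\<in>{upper_mean n p, lower_mean n p}. \<forall>Mq\<in>{upper_mean n q, lower_mean n q}.
      \<forall>K\<in>convex_bodies0 n. \<forall>L\<in>convex_bodies0 n. cov_dist (Mp K L) (Mq K L) - 1 \<le> \<epsilon>\<^sub>0 \<longrightarrow>
        \<bar>cov_dist K L - 1 - 2 * (cov_dist (Mp K L) (Mq K L) - 1)\<bar> \<le> C * (cov_dist (Mp K L) (Mq K L) - 1)\<^sup>2"
  proof (rule exI[of _ C], rule conjI[OF C(1)], rule exI[of _ \<epsilon>\<^sub>0], rule conjI[OF C(2)], intro allI impI ballI)
    fix n :: nat and Mp Mq K L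
    assume n: "1 \<le> n" and Mp: "Mp \<in> {upper_mean n p, lower_mean n p}"
      and Mq: "Mq \<in> {upper_mean n q, lower_mean n q}"
      and K: "K \<in> convex_bodies0 n" and L: "L \<in> convex_bodies0 n"
      and small: "cov_dist (Mp K L) (Mq K L) - 1 \<le> \<epsilon>\<^sub>0"
    have "p = -\<infinity> \<or> q = \<infinity>" using inf by blast
    then have eq: "cov_dist (Mp K L) (Mq K L) = pmean q (cov_dist K L) 1 / pmean p (cov_dist K L) 1"
      using mean_sandwich[OF K L Mp] mean_sandwich[OF K L Mq] by (intro cov_dist_means_eq[OF K L n])
    show "\<bar>cov_dist K L - 1 - 2 * (cov_dist (Mp K L) (Mq K L) - 1)\<bar> \<le> C * (cov_dist (Mp K L) (Mq K L) - 1)\<^sup>2"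
      using expansion[OF cov_dist_attained(3)[OF K L n]] small unfolding eq .
  qed
next
  assume inf: "p = -\<infinity> \<and> q = \<infinity>"
  show "\<forall>n\<ge>1. \<forall>Mp\<in>{upper_mean n p, lower_mean n p}. \<forall>Mq\<in>{upper_mean n q, lower_mean n q}.
      \<forall>K\<in>convex_bodies0 n. \<forall>L\<in>convex_bodies0 n. cov_dist K L = 1 + (cov_dist (Mp K L) (Mq K L) - 1)"
  proof (intro allI impI ballI)
    fix n :: nat and Mp Mq K L
    assume n: "1 \<le> n" and Mp: "Mp \<in> {upper_mean n p, lower_mean n p}"
      and Mq: "Mq \<in> {upper_mean n q, lower_mean n q}"
      and K: "K \<in> convex_bodies0 n" and L: "L \<in> convex_bodies0 n"
    have "p = -\<infinity> \<or> q = \<infinity>" using inf by blast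
    then have "cov_dist (Mp K L) (Mq K L) = pmean q (cov_dist K L) 1 / pmean p (cov_dist K L) 1"
      using mean_sandwich[OF K L Mp] mean_sandwich[OF K L Mq] by (intro cov_dist_means_eq[OF K L n])
    then show "cov_dist K L = 1 + (cov_dist (Mp K L) (Mq K L) - 1)"
      using inf cov_dist_attained(3)[OF K L n] by simp
  qed
qed

end
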